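(* For backtracking exploration, assume that $G_n$ is almost surely connected and non-bipartite. For non-backtracking exploration, assume that $\vec P_n$ is almost surely irreducible and aperiodic. Then the following hold for each of the two types of exploration. (a) For fixed $n$, almost surely $\mu_n^{(k)}$ converges weakly to $\mu_n^{(\infty)}$ as $k\to\infty$, where $$\mu_n^{(\infty)}=\frac1n\sum_{i\in[n]}\delta_{\Delta_{i,n}^{(\mathrm{st})}},\qquad \Delta_{i,n}^{(\mathrm{st})}=\sum_{j\in[n]}\pi_n(j)\,d_j^{(G_n)}-d_i^{(G_n)},\qquad \pi_n(j)=\frac{d_j^{(G_n)}}{\sum_{l\in[n]}d_l^{(G_n)}}.$$ (b) Suppose that $((d_i^{(G_n)})^2)_{i\in[n],\,n\ge3}$, respectively $((d_i^{(G_n)})^2)_{i\in[n],\,n\ge2}$, is uniformly integrable for non-backtracking, respectively backtracking, exploration. If $G_n$ converges locally in probability to $(G_\infty,\phi)$ as $n\to\infty$, with a deterministic law $\bar\Lambda$, then $\mu_n^{(\infty)}$ converges weakly to $\mu$ in probability as $n\to\infty$, where $\mu$ is the law of $$\Delta_\phi=\frac{m^{(2)}}{m^{(1)}}-d_\phi,\qquad m^{(1)}=\mathbb E_{\bar\Lambda}[d_\phi],\quad m^{(2)}=\mathbb E_{\bar\Lambda}[d_\phi^2],$$ with $d_\phi$ the degree of the root $\phi$ in $G_\infty$.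
   Context: Graphs are undirected, simple or multi-graphs; $A^{(G)}_{i,j}$ is the number of edges connecting $i,j$ and $d_i^{(G)}$ the degree of $i$ in $G$. $G_n$ is a random graph with vertex set $[n]=\{1,\dots,n\}$ on a probability space $(\Omega_n,\mathcal F_n,\mathbb P_n)$. - Non-backtracking exploration: $G_n$ is simple, $n\ge3$, with minimum degree at least $2$. $P_n^{(k)}(i,j)=\sum \big(d_{i}^{(G_n)}\prod_{l=1}^{k-1}(d_{i_l}^{(G_n)}-1)\big)^{-1}$, the sum over all $(i_0,\dots,i_k)\in[n]^{k+1}$ with $i_0=i$, $i_k=j$, $\{i_l,i_{l+1}\}\in E(G_n)$ for $0\le l\le k-1$, and $i_{l-1}\ne i_{l+1}$ for $1\le l\le k-1$. The matrix $\vec P_n$ is indexed by directed edges (each edge $\{i,j\}$ of $G_n$ gives the two directed edges $i\to j$ and $j\to i$), with $\vec P_n(i_1\to i_2,\,j_1\to j_2)=1/(d_{i_2}^{(G_n)}-1)$ if $i_2=j_1$ and $i_1\ne j_2$, and $0$ otherwise. - Backtracking exploration: $G_n$ is without self-loops and isolated vertices, $n\ge2$; $P_n^{(k)}=P_n^k$ is the $k$-th matrix power of $P_n(i,j)=A^{(G_n)}_{i,j}/d_i^{(G_n)}$. The $k$-level friendship bias is $\Delta_{i,n}^{(k)}=\sum_{j\in[n]}P_n^{(k)}(i,j)d_j^{(G_n)}-d_i^{(G_n)}$, and $\mu_n^{(k)}=\frac1n\sum_{i\in[n]}\delta_{\Delta_{i,n}^{(k)}}$ (a random measure). $(G_\infty,\phi)$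 is an almost surely locally finite rooted random tree with law $\bar\Lambda$: for non-backtracking exploration it is infinite with every vertex having at least one offspring; for backtracking exploration it is non-trivial (more than one vertex). "Deterministic law" means $\bar\Lambda$ is a fixed (non-random) probability measure; $\mathbb E_{\bar\Lambda}$ is its expectation. Local convergence in probability. For a rooted graph $(H,o)$, $B_r^{(H)}(o)$ is the rooted subgraph with root $o$ whose vertices are those at graph distance $\le r$ from $o$ and whose edges are all edges of $H$ between such vertices. $\mathscr G$ is the set of connected locally finite rooted graphs, up to rooted isomorphism, with metric $\mathrm d_{\mathscr G}((H_1,o_1),(H_2,o_2))=\big(1+\sup\{r\ge0: B_r^{(H_1)}(o_1)\simeq B_r^{(H_2)}(o_2)\}\big)^{-1}$. $\mathscr C(G_n,i)$ is the connected component of $i$ in $G_n$, rooted at $i$. $G_n$ converges locally in probability to $(G_\infty,\phi)$ if $\frac1n\sum_{i\in[n]}h(\mathscr C(G_n,i))\to\mathbb E_{\bar\Lambda}[h((G_\infty,\phi))]$ in probability for every bounded continuous $h:\mathscr G\to\mathbb R$. A family of non-negative random variables (possibly on different probability spaces) is uniformly integrable if $\sup \mathbb E[X\mathbf 1_{\{X>M\}}]\to0$ as $M\to\infty$, the supremum being over the family. Weak convergence in probability of random measures $\nu_n$ to $\nu$ means $\int f\,d\nu_n\to\int f\,d\nu$ in probability for every bounded continuous $f:\mathbb R\to\mathbb R$. *)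

theory Defs
  imports "HOL-Probability.Probability" "HOL-Library.Extended_Nat"
    "HOL-Library.Diagonal_Subsequence"
begin

section \<open>Multigraphs\<close>

text \<open>An undirected multigraph is given by its vertex set and its adjacency numbers:
  \<open>mult G u v\<close> is the number of edges connecting \<open>u\<close> and \<open>v\<close>.\<close>

record 'v mgraph =
  verts :: "'v set"
  mult :: "'v \<Rightarrow> 'v \<Rightarrow> nat"

definition multigraph :: "'v mgraph \<Rightarrow> bool" where
  "multigraph G \<longleftrightarrow> (\<forall>u v. mult G u v = mult G v u)
     \<and> (\<forall>u v. mult G u v > 0 \<longrightarrow> u \<in> verts G \<and> v \<in> verts G)"

definition adj :: "'v mgraph \<Rightarrow> ('v \<times> 'v) set" where
  "adj G = {(u, v). mult G u v > 0}"

text \<open>A self-loop contributes two to the degree. Only meaningful if \<open>v\<close> has finitely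
  many neighbours.\<close>

definition gdegree :: "'v mgraph \<Rightarrow> 'v \<Rightarrow> nat" where
  "gdegree G v = (\<Sum>w | (v, w) \<in> adj G. mult G v w) + mult G v v"

definition loop_free :: "'v mgraph \<Rightarrow> bool" where
  "loop_free G \<longleftrightarrow> (\<forall>v. mult G v v = 0)"

definition simple_graph :: "'v mgraph \<Rightarrow> bool" where
  "simple_graph G \<longleftrightarrow> loop_free G \<and> (\<forall>u v. mult G u v \<le> 1)"

definition locally_finite :: "'v mgraph \<Rightarrow> bool" where
  "locally_finite G \<longleftrightarrow> (\<forall>v\<in>verts G. finite {w. (v, w) \<in> adj G})"

definition connected_graph :: "'v mgraph \<Rightarrow> bool" where
  "connected_graph G \<longleftrightarrow> (\<forall>u\<in>verts G. \<forall>v\<in>verts G. (u, v) \<in> (adj G)\<^sup>*)"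

definition bipartite :: "'v mgraph \<Rightarrow> bool" where
  "bipartite G \<longleftrightarrow> (\<exists>S \<subseteq> verts G. \<forall>u v. (u, v) \<in> adj G \<longrightarrow> (u \<in> S \<longleftrightarrow> v \<notin> S))"

definition is_tree :: "'v mgraph \<Rightarrow> bool" where
  "is_tree G \<longleftrightarrow> connected_graph G \<and> simple_graph G
     \<and> \<not> (\<exists>c. length c \<ge> 3 \<and> distinct c
            \<and> (\<forall>l<length c. (c ! l, c ! (Suc l mod length c)) \<in> adj G))"

definition gdist :: "'v mgraph \<Rightarrow> 'v \<Rightarrow> 'v \<Rightarrow> enat" where
  "gdist G u v = (INF k\<in>{k. (u, v) \<in> adj G ^^ k}. enat k)"

definition induced_subgraph :: "'v mgraph \<Rightarrow> 'v set \<Rightarrow> 'v mgraph" where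
  "induced_subgraph G S =
     \<lparr>verts = verts G \<inter> S, mult = (\<lambda>u v. if u \<in> S \<and> v \<in> S then mult G u v else 0)\<rparr>"

definition graph_ball :: "'v mgraph \<Rightarrow> 'v \<Rightarrow> nat \<Rightarrow> 'v mgraph" where
  "graph_ball G v r = induced_subgraph G {w. gdist G v w \<le> enat r}"

definition graph_component :: "'v mgraph \<Rightarrow> 'v \<Rightarrow> 'v mgraph" where
  "graph_component G v = induced_subgraph G {w. (v, w) \<in> (adj G)\<^sup>*}"

definition offspring :: "'v mgraph \<Rightarrow> 'v \<Rightarrow> 'v \<Rightarrow> 'v set" where
  "offspring G r v = {w. (v, w) \<in> adj G \<and> gdist G r w = gdist G r v + 1}"


section \<open>Rooted isomorphism\<close>

definition is_rooted_iso ::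
  "('v \<Rightarrow> 'u) \<Rightarrow> 'v mgraph \<times> 'v \<Rightarrow> 'u mgraph \<times> 'u \<Rightarrow> bool" where
  "is_rooted_iso f X Y \<longleftrightarrow> bij_betw f (verts (fst X)) (verts (fst Y)) \<and> f (snd X) = snd Y
     \<and> (\<forall>u\<in>verts (fst X). \<forall>v\<in>verts (fst X). mult (fst Y) (f u) (f v) = mult (fst X) u v)"

definition rooted_isomorphic :: "'v mgraph \<times> 'v \<Rightarrow> 'u mgraph \<times> 'u \<Rightarrow> bool" where
  "rooted_isomorphic X Y \<longleftrightarrow> (\<exists>f. is_rooted_iso f X Y)"

definition rooted_ball :: "'v mgraph \<times> 'v \<Rightarrow> nat \<Rightarrow> 'v mgraph \<times> 'v" where
  "rooted_ball X r = (graph_ball (fst X) (snd X) r, snd X)"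

text \<open>Graph distances are integers, so only natural radii \<open>r\<close> are considered. The supremum and
  \<open>inverse\<close> are those of the extended non-negative reals: the distance is \<open>0\<close> if the balls of all
  radii are isomorphic, and the supremum of the empty set (possible, as the root may have
  self-loops) is \<open>0\<close>.\<close>

definition local_dist :: "'v mgraph \<times> 'v \<Rightarrow> 'v mgraph \<times> 'v \<Rightarrow> real" where
  "local_dist X Y = enn2real (inverse
     (1 + (SUP r\<in>{r. rooted_isomorphic (rooted_ball X r) (rooted_ball Y r)}. of_nat r)))"

definition good_rooted :: "'v mgraph \<times> 'v \<Rightarrow> bool" where
  "good_rooted X \<longleftrightarrow> multigraph (fst X) \<and> snd X \<in> verts (fst X)
     \<and> connected_graph (fst X) \<and> locally_finite (fst X)"

lemma adjI: "mult G u v > 0 \<Longrightarrow> (u, v) \<in> adj G"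
  by (simp add: adj_def)

lemma multigraph_sym: "multigraph G \<Longrightarrow> mult G u v = mult G v u"
  by (auto simp: multigraph_def)

lemma adj_verts: "multigraph G \<Longrightarrow> (u, v) \<in> adj G \<Longrightarrow> u \<in> verts G \<and> v \<in> verts G"
  by (auto simp: multigraph_def adj_def)

lemma relpow_adj_verts:
  "multigraph G \<Longrightarrow> (u, v) \<in> adj G ^^ k \<Longrightarrow> u \<in> verts G \<Longrightarrow> v \<in> verts G"
  by (cases k) (auto dest: adj_verts)

lemma multigraph_induced: "multigraph G \<Longrightarrow> multigraph (induced_subgraph G S)"
  by (auto simp: multigraph_def induced_subgraph_def)

lemma gdist_le_iff: "gdist G u v \<le> enat r \<longleftrightarrow> (\<exists>k\<le>r. (u, v) \<in> adj G ^^ k)"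
proof
  assume a: "gdist G u v \<le> enat r"
  let ?K = "enat ` {k. (u, v) \<in> adj G ^^ k}"
  have "?K \<noteq> {}"
  proof
    assume "?K = {}"
    then have "gdist G u v = top" by (simp add: gdist_def)
    then show False using a by (simp add: top_enat_def)
  qed
  then have "Inf ?K \<in> ?K"
    by (metis LeastI_ex Inf_enat_def ex_in_conv)
  then show "\<exists>k\<le>r. (u, v) \<in> adj G ^^ k"
    using a by (auto simp: gdist_def)
next
  assume "\<exists>k\<le>r. (u, v) \<in> adj G ^^ k"
  then obtain k where k: "k \<le> r" "(u, v) \<in> adj G ^^ k" by blast
  have "gdist G u v \<le> enat k"
    unfolding gdist_def by (rule INF_lower) (use k in simp)
  also have "\<dots> \<le> enat r" using k by simp
  finally show "gdist G u v \<le> enat r" .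
qed

lemma enat_eqI: "(\<And>r. a \<le> enat r \<longleftrightarrow> b \<le> enat r) \<Longrightarrow> a = (b :: enat)"
  by (metis enat.exhaust enat_ord_code(3) enat_ord_simps(5) order_antisym order_refl)

lemma gdist_self [simp]: "gdist G v v = 0"
  using gdist_le_iff[of G v v 0] by (auto simp: zero_enat_def[symmetric])

lemma is_rooted_iso_id: "is_rooted_iso id X X"
  by (simp add: is_rooted_iso_def)

lemma is_rooted_iso_inv:
  assumes "is_rooted_iso f X Y" "snd X \<in> verts (fst X)"
  shows "is_rooted_iso (inv_into (verts (fst X)) f) Y X"
proof -
  let ?g = "inv_into (verts (fst X)) f"
  have b: "bij_betw f (verts (fst X)) (verts (fst Y))"
    using assms by (simp add: is_rooted_iso_def)
  have m: "?g v \<in> verts (fst X) \<and> f (?g v) = v" if "v \<in> verts (fst Y)" for v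
    using b that by (metis bij_betw_imp_surj_on f_inv_into_f inv_into_into)
  show ?thesis
    unfolding is_rooted_iso_def
  proof (intro conjI ballI)
    show "bij_betw ?g (verts (fst Y)) (verts (fst X))"
      by (rule bij_betw_inv_into[OF b])
    show "?g (snd Y) = snd X"
      using assms b by (metis bij_betw_inv_into_left is_rooted_iso_def)
    fix u v assume "u \<in> verts (fst Y)" "v \<in> verts (fst Y)"
    then show "mult (fst X) (?g u) (?g v) = mult (fst Y) u v"
      using m[of u] m[of v] assms(1) unfolding is_rooted_iso_def by metis
  qed
qed

lemma is_rooted_iso_comp:
  assumes "is_rooted_iso f X Y" "is_rooted_iso g Y Z"
  shows "is_rooted_iso (g \<circ> f) X Z"
  unfolding is_rooted_iso_def
proof (intro conjI ballI)
  show "bij_betw (g \<circ> f) (verts (fst X)) (verts (fst Z))"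
    using assms bij_betw_trans unfolding is_rooted_iso_def by blast
  show "(g \<circ> f) (snd X) = snd Z"
    using assms by (simp add: is_rooted_iso_def)
  fix u v assume "u \<in> verts (fst X)" "v \<in> verts (fst X)"
  moreover from this have "f u \<in> verts (fst Y)" "f v \<in> verts (fst Y)"
    using assms(1) by (auto simp: is_rooted_iso_def bij_betw_apply)
  ultimately show "mult (fst Z) ((g \<circ> f) u) ((g \<circ> f) v) = mult (fst X) u v"
    using assms by (simp add: is_rooted_iso_def)
qed

lemma rooted_isomorphic_refl: "rooted_isomorphic X X"
  unfolding rooted_isomorphic_def using is_rooted_iso_id by blast

lemma rooted_isomorphic_sym:
  "rooted_isomorphic X Y \<Longrightarrow> snd X \<in> verts (fst X) \<Longrightarrow> rooted_isomorphic Y X"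
  unfolding rooted_isomorphic_def using is_rooted_iso_inv by blast

lemma rooted_isomorphic_trans:
  "rooted_isomorphic X Y \<Longrightarrow> rooted_isomorphic Y Z \<Longrightarrow> rooted_isomorphic X Z"
  unfolding rooted_isomorphic_def using is_rooted_iso_comp by blast

lemma iso_relpow:
  assumes "is_rooted_iso f X Y" "multigraph (fst X)" "u \<in> verts (fst X)"
    "(u, v) \<in> adj (fst X) ^^ k"
  shows "(f u, f v) \<in> adj (fst Y) ^^ k"
  using assms(4)
proof (induction k arbitrary: v)
  case 0
  then show ?case by simp
next
  case (Suc k)
  then obtain w where w: "(u, w) \<in> adj (fst X) ^^ k" "(w, v) \<in> adj (fst X)" by auto
  have "w \<in> verts (fst X)" "v \<in> verts (fst X)"
    using adj_verts[OF assms(2) w(2)] by auto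
  then have "(f w, f v) \<in> adj (fst Y)"
    using w(2) assms(1) by (simp add: is_rooted_iso_def adj_def)
  then show ?case using Suc.IH[OF w(1)] by auto
qed

lemma iso_gdist:
  assumes "is_rooted_iso f X Y" "multigraph (fst X)" "multigraph (fst Y)"
    "snd X \<in> verts (fst X)" "u \<in> verts (fst X)" "v \<in> verts (fst X)"
  shows "gdist (fst Y) (f u) (f v) = gdist (fst X) u v"
proof -
  let ?g = "inv_into (verts (fst X)) f"
  have g: "is_rooted_iso ?g Y X" by (rule is_rooted_iso_inv) fact+
  have b: "bij_betw f (verts (fst X)) (verts (fst Y))"
    using assms by (simp add: is_rooted_iso_def)
  have inv: "?g (f u) = u" "?g (f v) = v"
    using b assms by (simp_all add: bij_betw_inv_into_left)
  have "(f u, f v) \<in> adj (fst Y) ^^ k \<longleftrightarrow> (u, v) \<in> adj (fst X) ^^ k" for k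
    using iso_relpow[OF assms(1,2,5), of v k]
      iso_relpow[OF g assms(3), of "f u" "f v" k] inv b assms(5)
    by (auto simp: bij_betw_apply)
  then show ?thesis by (simp add: gdist_def)
qed

lemma iso_ball:
  assumes "is_rooted_iso f X Y" "multigraph (fst X)" "multigraph (fst Y)"
    "snd X \<in> verts (fst X)"
  shows "is_rooted_iso f (rooted_ball X r) (rooted_ball Y r)"
proof -
  have b: "bij_betw f (verts (fst X)) (verts (fst Y))" and r: "f (snd X) = snd Y"
    using assms by (simp_all add: is_rooted_iso_def)
  have d: "gdist (fst Y) (snd Y) (f v) = gdist (fst X) (snd X) v" if "v \<in> verts (fst X)" for v
    using iso_gdist[OF assms(1-4) assms(4) that] r by simp
  have inj: "inj_on f (verts (fst X))" and im: "f ` verts (fst X) = verts (fst Y)"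
    using b by (auto simp: bij_betw_def)
  have "bij_betw f (verts (fst X) \<inter> {w. gdist (fst X) (snd X) w \<le> enat r})
      (verts (fst Y) \<inter> {w. gdist (fst Y) (snd Y) w \<le> enat r})"
    unfolding bij_betw_def
  proof
    show "inj_on f (verts (fst X) \<inter> {w. gdist (fst X) (snd X) w \<le> enat r})"
      using inj by (rule inj_on_subset) auto
    show "f ` (verts (fst X) \<inter> {w. gdist (fst X) (snd X) w \<le> enat r}) =
      verts (fst Y) \<inter> {w. gdist (fst Y) (snd Y) w \<le> enat r}"
      using im d by force
  qed
  then show ?thesis
    using assms(1) r d
    by (auto simp: is_rooted_iso_def rooted_ball_def graph_ball_def induced_subgraph_def)
qed

lemma relpow_induced: "(u, v) \<in> adj (induced_subgraph G S) ^^ k \<Longrightarrow> (u, v) \<in> adj G ^^ k"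
proof (induction k arbitrary: v)
  case (Suc k)
  then obtain w where w: "(u, w) \<in> adj (induced_subgraph G S) ^^ k"
    "(w, v) \<in> adj (induced_subgraph G S)" by auto
  then have "(w, v) \<in> adj G"
    by (auto simp: adj_def induced_subgraph_def split: if_splits)
  then show ?case using Suc.IH[OF w(1)] by auto
qed auto

lemma relpow_ball:
  "(v, w) \<in> adj G ^^ k \<Longrightarrow> k \<le> r \<Longrightarrow> (v, w) \<in> adj (graph_ball G v r) ^^ k"
proof (induction k arbitrary: w)
  case (Suc k)
  then obtain x where x: "(v, x) \<in> adj G ^^ k" "(x, w) \<in> adj G" by auto
  have "gdist G v x \<le> enat r" "gdist G v w \<le> enat r"
    unfolding gdist_le_iff using x(1) Suc.prems Suc_leD by blast+
  then have "(x, w) \<in> adj (graph_ball G v r)"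
    using x(2) by (simp add: adj_def graph_ball_def induced_subgraph_def)
  then show ?case using Suc.IH[OF x(1)] Suc.prems by auto
qed auto

lemma gdist_ball_le:
  assumes "s \<le> r"
  shows "gdist (graph_ball G v r) v w \<le> enat s \<longleftrightarrow> gdist G v w \<le> enat s"
  unfolding gdist_le_iff
  using assms by (metis graph_ball_def le_trans relpow_ball relpow_induced)

lemma ball_ball:
  assumes "s \<le> r"
  shows "rooted_ball (rooted_ball X r) s = rooted_ball X s"
proof -
  have *: "gdist (fst X) (snd X) w \<le> enat s \<Longrightarrow> gdist (fst X) (snd X) w \<le> enat r" for w
    using assms order_trans[of _ "enat s" "enat r"] by simp
  have "graph_ball (graph_ball (fst X) (snd X) r) (snd X) s = graph_ball (fst X) (snd X) s"
    unfolding graph_ball_def[of "graph_ball (fst X) (snd X) r"] gdist_ball_le[OF assms]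
    using * by (auto simp: graph_ball_def induced_subgraph_def fun_eq_iff)
  then show ?thesis by (simp add: rooted_ball_def)
qed

lemma root_in_ball: "snd X \<in> verts (fst X) \<Longrightarrow> snd (rooted_ball X r) \<in> verts (fst (rooted_ball X r))"
  by (simp add: rooted_ball_def graph_ball_def induced_subgraph_def)

lemma multigraph_ball: "multigraph (fst X) \<Longrightarrow> multigraph (fst (rooted_ball X r))"
  by (simp add: rooted_ball_def graph_ball_def multigraph_induced)

lemma iso_ball_mono:
  assumes "is_rooted_iso f (rooted_ball X r) (rooted_ball Y r)" "s \<le> r"
    "good_rooted X" "good_rooted Y"
  shows "is_rooted_iso f (rooted_ball X s) (rooted_ball Y s)"
  using iso_ball[OF assms(1), of s] assms
  by (simp add: ball_ball multigraph_ball root_in_ball good_rooted_def)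

lemma good_gdist_finite:
  assumes "good_rooted X" "v \<in> verts (fst X)"
  obtains r where "gdist (fst X) (snd X) v \<le> enat r"
proof -
  have "(snd X, v) \<in> (adj (fst X))\<^sup>*"
    using assms by (auto simp: good_rooted_def connected_graph_def)
  then obtain k where "(snd X, v) \<in> adj (fst X) ^^ k"
    using rtrancl_imp_UN_relpow by blast
  then have "gdist (fst X) (snd X) v \<le> enat k"
    unfolding gdist_le_iff by blast
  then show ?thesis by (rule that)
qed

lemma finite_ball:
  assumes "good_rooted X"
  shows "finite (verts (fst (rooted_ball X r)))"
proof -
  have lf: "finite {w. (v, w) \<in> adj (fst X)}" for v
  proof (cases "v \<in> verts (fst X)")
    case True
    then show ?thesis using assms by (auto simp: good_rooted_def locally_finite_def)
  next
    case False
    then have "{w. (v, w) \<in> adj (fst X)} = {}"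
      using adj_verts[of "fst X" v] assms by (auto simp: good_rooted_def)
    then show ?thesis by simp
  qed
  have fin: "finite {w. (snd X, w) \<in> adj (fst X) ^^ k}" for k
  proof (induction k)
    case (Suc k)
    have "{w. (snd X, w) \<in> adj (fst X) ^^ Suc k} =
      (\<Union>v\<in>{v. (snd X, v) \<in> adj (fst X) ^^ k}. {w. (v, w) \<in> adj (fst X)})" by auto
    then show ?case using Suc lf by simp
  qed simp
  have "verts (fst (rooted_ball X r)) \<subseteq> (\<Union>k\<le>r. {w. (snd X, w) \<in> adj (fst X) ^^ k})"
    by (auto simp: rooted_ball_def graph_ball_def induced_subgraph_def gdist_le_iff)
  then show ?thesis
    by (rule finite_subset) (use fin in simp)
qed

lemma verts_ball: "v \<in> verts (fst (rooted_ball X r)) \<longleftrightarrow>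
    v \<in> verts (fst X) \<and> gdist (fst X) (snd X) v \<le> enat r"
  by (auto simp: rooted_ball_def graph_ball_def induced_subgraph_def)

lemma mult_ball: "u \<in> verts (fst (rooted_ball X r)) \<Longrightarrow> v \<in> verts (fst (rooted_ball X r)) \<Longrightarrow>
    mult (fst (rooted_ball X r)) u v = mult (fst X) u v"
  by (auto simp: rooted_ball_def graph_ball_def induced_subgraph_def)

lemma snd_rooted_ball [simp]: "snd (rooted_ball X r) = snd X"
  by (simp add: rooted_ball_def)

lemma verts_ball_mono: "s \<le> r \<Longrightarrow> verts (fst (rooted_ball X s)) \<subseteq> verts (fst (rooted_ball X r))"
  by (auto simp: verts_ball) (meson enat_ord_simps(1) order_trans)

text \<open>If the balls of all radii are isomorphic, then so are the rooted graphs.\<close>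

lemma iso_of_ball_isos:
  fixes X Y :: "nat mgraph \<times> nat"
  assumes X: "good_rooted X" and Y: "good_rooted Y"
    and all: "\<And>r. rooted_isomorphic (rooted_ball X r) (rooted_ball Y r)"
  shows "rooted_isomorphic X Y"
proof -
  let ?B = "\<lambda>r. verts (fst (rooted_ball X r))" and ?C = "\<lambda>r. verts (fst (rooted_ball Y r))"
  have "\<forall>r. \<exists>f. is_rooted_iso f (rooted_ball X r) (rooted_ball Y r)"
    using all by (simp add: rooted_isomorphic_def)
  then obtain f where f: "\<And>r. is_rooted_iso (f r) (rooted_ball X r) (rooted_ball Y r)"
    by metis
  have fs: "is_rooted_iso (f r) (rooted_ball X s) (rooted_ball Y s)" if "s \<le> r" for r s
    by (rule iso_ball_mono[OF f that X Y])
  define P where "P v s \<longleftrightarrow>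
    (v \<in> verts (fst X) \<longrightarrow> (\<exists>c. \<forall>\<^sub>F k in sequentially. f (s k) v = c))" for v s
  interpret subseqs P
  proof
    fix v and s :: "nat \<Rightarrow> nat" assume s: "strict_mono s"
    show "\<exists>r'. strict_mono r' \<and> P v (s \<circ> r')"
    proof (cases "v \<in> verts (fst X)")
      case False
      then show ?thesis by (auto simp: P_def intro: exI[of _ id] strict_monoI)
    next
      case True
      then obtain R where "gdist (fst X) (snd X) v \<le> enat R"
        using good_gdist_finite[OF X] by blast
      then have vB: "v \<in> ?B R" using True by (simp add: verts_ball)
      have inC: "f (s (k + R)) v \<in> ?C R" for k
      proof -
        have "R \<le> s (k + R)" using seq_suble[OF s, of "k + R"] by simp
        from fs[OF this] show ?thesis
          using vB by (auto simp: is_rooted_iso_def bij_betw_apply)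
      qed
      then have "finite (range (\<lambda>k. f (s (k + R)) v))"
        using finite_ball[OF Y, of R] by (meson finite_subset image_subsetI)
      then obtain k0 where k0: "infinite {k. f (s (k + R)) v = f (s (k0 + R)) v}"
        using pigeonhole_infinite[of "UNIV :: nat set" "\<lambda>k. f (s (k + R)) v"] by auto
      let ?I = "{k. f (s (k + R)) v = f (s (k0 + R)) v}"
      have sm: "strict_mono (\<lambda>k. enumerate ?I k + R)"
        using strict_mono_enumerate[OF k0] by (simp add: strict_mono_def)
      have "enumerate ?I k \<in> ?I" for k by (rule enumerate_in_set[OF k0])
      then have "P v (s \<circ> (\<lambda>k. enumerate ?I k + R))"
        unfolding P_def by (auto intro!: exI[of _ "f (s (k0 + R)) v"])
      with sm show ?thesis by blast
    qed
  qed
  have Pd: "P v (diagseq \<circ> ((+) (Suc v)))" for v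
  proof (rule diagseq_holds)
    fix r s :: "nat \<Rightarrow> nat" and n assume r: "strict_mono r" and P: "P n s"
    show "P n (s \<circ> r)"
      using P unfolding P_def comp_def
      using eventually_compose_filterlim[OF _ filterlim_subseq[OF r]] by blast
  qed
  have "\<exists>c. \<forall>\<^sub>F k in sequentially. f (diagseq k) v = c" if v: "v \<in> verts (fst X)" for v
  proof -
    obtain c where "\<forall>\<^sub>F k in sequentially. f (diagseq (k + Suc v)) v = c"
      using Pd[of v] v by (auto simp: P_def comp_def add.commute)
    then show ?thesis
      using eventually_sequentially_seg[of "\<lambda>k. f (diagseq k) v = c" "Suc v"] by blast
  qed
  then obtain F where F: "\<And>v. v \<in> verts (fst X) \<Longrightarrow> \<forall>\<^sub>F k in sequentially. f (diagseq k) v = F v"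
    by metis
  have agree: "\<exists>k\<ge>R. \<forall>v\<in>?B R. f k v = F v" for R
  proof -
    have "\<forall>\<^sub>F k in sequentially. \<forall>v\<in>?B R. f (diagseq k) v = F v"
      by (rule eventually_ball_finite[OF finite_ball[OF X]]) (use F in \<open>auto simp: verts_ball\<close>)
    then have "\<forall>\<^sub>F k in sequentially. k \<ge> R \<and> (\<forall>v\<in>?B R. f (diagseq k) v = F v)"
      using eventually_ge_at_top[of R] by eventually_elim auto
    then obtain k where k: "k \<ge> R" "\<forall>v\<in>?B R. f (diagseq k) v = F v"
      unfolding eventually_sequentially by blast
    have "diagseq k \<ge> R"
      using seq_suble[OF subseq_diagseq, of k] k(1) by linarith
    then show ?thesis using k(2) by blast
  qed
  have iso: "is_rooted_iso F (rooted_ball X R) (rooted_ball Y R)" for R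
  proof -
    obtain k where k: "k \<ge> R" "\<forall>v\<in>?B R. f k v = F v" using agree by blast
    have r: "snd X \<in> ?B R"
      using root_in_ball[of X R] X by (simp add: good_rooted_def)
    have "bij_betw F (?B R) (?C R)"
      using fs[OF k(1)] k(2) bij_betw_cong[of "?B R" "f k" F]
      by (simp add: is_rooted_iso_def)
    then show ?thesis
      using fs[OF k(1)] k(2) r by (auto simp: is_rooted_iso_def)
  qed
  have ex_ball: "\<exists>R. \<forall>r\<ge>R. v \<in> ?B r" if v: "v \<in> verts (fst X)" for v
  proof -
    obtain R where "gdist (fst X) (snd X) v \<le> enat R"
      using good_gdist_finite[OF X v] by blast
    then have "v \<in> ?B R" using v by (simp add: verts_ball)
    then show ?thesis using verts_ball_mono[of R _ X] by blast
  qed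
  have ex_ball2: "\<exists>R. u \<in> ?B R \<and> v \<in> ?B R" if uv: "u \<in> verts (fst X)" "v \<in> verts (fst X)" for u v
  proof -
    obtain R R' where "\<forall>r\<ge>R. u \<in> ?B r" "\<forall>r\<ge>R'. v \<in> ?B r"
      using ex_ball[OF uv(1)] ex_ball[OF uv(2)] by blast
    then have "u \<in> ?B (max R R')" "v \<in> ?B (max R R')" by simp_all
    then show ?thesis by blast
  qed
  have "is_rooted_iso F X Y"
    unfolding is_rooted_iso_def
  proof (intro conjI ballI)
    show "F (snd X) = snd Y"
      using iso[of 0] by (simp add: is_rooted_iso_def)
    show "mult (fst Y) (F u) (F v) = mult (fst X) u v"
      if uv: "u \<in> verts (fst X)" "v \<in> verts (fst X)" for u v
    proof -
      obtain R where R: "u \<in> ?B R" "v \<in> ?B R" using ex_ball2[OF uv] by blast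
      then have "F u \<in> ?C R" "F v \<in> ?C R"
        using iso[of R] by (auto simp: is_rooted_iso_def bij_betw_apply)
      then show ?thesis
        using iso[of R] R mult_ball[of u X R v] mult_ball[of "F u" Y R "F v"]
        by (auto simp: is_rooted_iso_def)
    qed
    show "bij_betw F (verts (fst X)) (verts (fst Y))"
      unfolding bij_betw_def
    proof (intro conjI inj_onI)
      fix u v assume uv: "u \<in> verts (fst X)" "v \<in> verts (fst X)" "F u = F v"
      obtain R where R: "u \<in> ?B R" "v \<in> ?B R" using ex_ball2[OF uv(1,2)] by blast
      then show "u = v"
        using iso[of R] uv(3) by (auto simp: is_rooted_iso_def bij_betw_def dest: inj_onD)
    next
      show "F ` verts (fst X) = verts (fst Y)"
      proof
        show "F ` verts (fst X) \<subseteq> verts (fst Y)"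
        proof
          fix y assume "y \<in> F ` verts (fst X)"
          then obtain v where v: "v \<in> verts (fst X)" "y = F v" by auto
          obtain R where R: "v \<in> ?B R" using ex_ball[OF v(1)] by blast
          then have "F v \<in> ?C R" using iso[of R] by (auto simp: is_rooted_iso_def bij_betw_apply)
          then show "y \<in> verts (fst Y)" using v by (simp add: verts_ball)
        qed
        show "verts (fst Y) \<subseteq> F ` verts (fst X)"
        proof
          fix y assume y: "y \<in> verts (fst Y)"
          obtain R where "y \<in> ?C R"
            using good_gdist_finite[OF Y y] y unfolding verts_ball by blast
          then have "y \<in> F ` ?B R"
            using iso[of R] by (auto simp: is_rooted_iso_def bij_betw_def)
          then show "y \<in> F ` verts (fst X)" by (auto simp: verts_ball)
        qed
      qed
    qed
  qed
  then show ?thesis by (auto simp: rooted_isomorphic_def)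
qed


section \<open>The space of rooted graphs\<close>

text \<open>Every connected locally finite graph is countable, so isomorphism classes of graphs with
  vertices in \<^typ>\<open>nat\<close> are all isomorphism classes.\<close>

definition rgraph_rel :: "nat mgraph \<times> nat \<Rightarrow> nat mgraph \<times> nat \<Rightarrow> bool" where
  "rgraph_rel X Y \<longleftrightarrow> good_rooted X \<and> good_rooted Y \<and> rooted_isomorphic X Y"

quotient_type rgraph = "nat mgraph \<times> nat" / partial: rgraph_rel
proof (rule part_equivpI)
  have "good_rooted (\<lparr>verts = {0::nat}, mult = \<lambda>_ _. 0\<rparr>, 0)"
    by (auto simp: good_rooted_def multigraph_def connected_graph_def locally_finite_def adj_def)
  then show "\<exists>X. rgraph_rel X X"
    by (auto simp: rgraph_rel_def intro: rooted_isomorphic_refl)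
  show "symp rgraph_rel"
    by (rule sympI) (auto simp: rgraph_rel_def good_rooted_def intro: rooted_isomorphic_sym)
  show "transp rgraph_rel"
    by (rule transpI) (auto simp: rgraph_rel_def intro: rooted_isomorphic_trans)
qed

lemma local_dist_cong:
  assumes "rgraph_rel X X'" "rgraph_rel Y Y'"
  shows "local_dist X Y = local_dist X' Y'"
proof -
  have *: "rooted_isomorphic (rooted_ball X r) (rooted_ball X' r)" if "rgraph_rel X X'" for X X' r
    using that iso_ball[of _ X X' r]
    by (auto simp: rgraph_rel_def good_rooted_def rooted_isomorphic_def)
  have sym: "rgraph_rel Z' Z" if "rgraph_rel Z Z'" for Z Z'
    using that by (auto simp: rgraph_rel_def good_rooted_def intro: rooted_isomorphic_sym)
  have "rooted_isomorphic (rooted_ball X r) (rooted_ball Y r) \<longleftrightarrow>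
      rooted_isomorphic (rooted_ball X' r) (rooted_ball Y' r)" for r
    using *[OF assms(1), of r] *[OF assms(2), of r]
      *[OF sym[OF assms(1)], of r] *[OF sym[OF assms(2)], of r]
    by (blast intro: rooted_isomorphic_trans)
  then show ?thesis by (simp add: local_dist_def)
qed

lemma inverse_ennreal_antimono: "a \<le> b \<Longrightarrow> inverse b \<le> inverse (a :: ennreal)"
  including ennreal.lifting by transfer (auto intro: ereal_inverse_antimono)

instantiation rgraph :: metric_space
begin

lift_definition dist_rgraph :: "rgraph \<Rightarrow> rgraph \<Rightarrow> real" is local_dist
  by (rule local_dist_cong)

definition uniformity_rgraph :: "(rgraph \<times> rgraph) filter" where
  "uniformity_rgraph = (INF e\<in>{0 <..}. principal {(x, y). dist x y < e})"

definition open_rgraph :: "rgraph set \<Rightarrow> bool" where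
  "open_rgraph U \<longleftrightarrow> (\<forall>x\<in>U. eventually (\<lambda>(x', y). x' = x \<longrightarrow> y \<in> U) uniformity)"

instance
proof
  define S where "S A = (SUP r\<in>A. of_nat r :: ennreal)" for A :: "nat set"
  define D where "D A = enn2real (inverse (1 + S A))" for A :: "nat set"
  define I where "I X Y = {r. rooted_isomorphic (rooted_ball X r) (rooted_ball Y r)}"
    for X Y :: "nat mgraph \<times> nat"
  have ld: "local_dist X Y = D (I X Y)" for X Y
    by (simp add: local_dist_def D_def S_def I_def)
  have fin: "inverse (1 + a) < top" for a :: ennreal
    by (simp add: less_top[symmetric])
  have mono: "D B \<le> D A" if "A \<subseteq> B" for A B
    unfolding D_def S_def
    by (intro enn2real_mono inverse_ennreal_antimono add_left_mono SUP_subset_mono that order_refl fin)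
  have D_UNIV: "D UNIV = 0"
    by (simp add: D_def S_def ennreal_SUP_of_nat_eq_top)
  have D_pos: "D A > 0" if n: "\<forall>r\<in>A. r < n" for A n
  proof -
    have "S A \<le> of_nat n"
      unfolding S_def by (rule SUP_least) (use n in \<open>auto simp: less_imp_le\<close>)
    then have "1 + S A < top"
      by (metis ennreal_add_less_top ennreal_one_less_top of_nat_less_top order_le_less_trans)
    then have "inverse (1 + S A) > 0"
      by (simp add: ennreal_inverse_positive)
    then show ?thesis unfolding D_def using fin[of "S A"] by (simp add: enn2real_positive_iff)
  qed
  have down: "s \<in> I X Y" if "r \<in> I X Y" "s \<le> r" "good_rooted X" "good_rooted Y" for r s X Y
    using that iso_ball_mono[of _ X r Y s] by (auto simp: I_def rooted_isomorphic_def)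
  have good: "good_rooted (rep_rgraph x)" for x
    using Quotient_rep_reflp[OF Quotient_rgraph] by (auto simp: rgraph_rel_def)
  have dist_rep: "dist x y = D (I (rep_rgraph x) (rep_rgraph y))" for x y
    by (simp add: dist_rgraph_def ld)
  have comm: "I X Y = I Y X" if "good_rooted X" "good_rooted Y" for X Y
    using that rooted_isomorphic_sym[of "rooted_ball X _" "rooted_ball Y _"]
      rooted_isomorphic_sym[of "rooted_ball Y _" "rooted_ball X _"] root_in_ball[of X] root_in_ball[of Y]
    by (auto simp: I_def good_rooted_def)
  have sym: "dist x y = dist y x" for x y :: rgraph
    by (simp add: dist_rep comm[OF good good])
  fix x y z :: rgraph
  let ?X = "rep_rgraph x" and ?Y = "rep_rgraph y" and ?Z = "rep_rgraph z"
  show "dist x y = 0 \<longleftrightarrow> x = y"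
  proof
    assume "dist x y = 0"
    have "rooted_isomorphic (rooted_ball ?X r) (rooted_ball ?Y r)" for r
    proof (rule ccontr)
      assume "\<not> rooted_isomorphic (rooted_ball ?X r) (rooted_ball ?Y r)"
      then have "\<forall>s\<in>I ?X ?Y. s < r"
        using down[of _ ?X ?Y r] good by (auto simp: I_def not_less[symmetric])
      then have "dist x y > 0" unfolding dist_rep by (rule D_pos)
      with \<open>dist x y = 0\<close> show False by simp
    qed
    then have "rgraph_rel ?X ?Y"
      using iso_of_ball_isos[OF good good] good by (simp add: rgraph_rel_def)
    then show "x = y" by (simp add: Quotient_rel_rep[OF Quotient_rgraph])
  next
    assume "x = y"
    then have "I ?X ?Y = UNIV" by (simp add: I_def rooted_isomorphic_refl)
    then show "dist x y = 0" by (simp add: dist_rep D_UNIV)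
  qed
  have tri: "I X Z \<supseteq> I X Y \<inter> I Y Z" for X Y Z
    using rooted_isomorphic_trans[of "rooted_ball X _" "rooted_ball Y _" "rooted_ball Z _"]
    by (auto simp: I_def)
  have nonneg: "D A \<ge> 0" for A by (simp add: D_def)
  have chain: "I ?X ?Z \<subseteq> I ?Y ?Z \<or> I ?Y ?Z \<subseteq> I ?X ?Z"
  proof (rule ccontr)
    assume "\<not> (I ?X ?Z \<subseteq> I ?Y ?Z \<or> I ?Y ?Z \<subseteq> I ?X ?Z)"
    then obtain r s where "r \<in> I ?X ?Z" "r \<notin> I ?Y ?Z" "s \<in> I ?Y ?Z" "s \<notin> I ?X ?Z" by blast
    then show False
      using down[OF _ _ good good, of r x z s] down[OF _ _ good good, of s y z r] by linarith
  qed
  show "dist x y \<le> dist x z + dist y z"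
  proof -
    have "I ?X ?Z \<inter> I ?Y ?Z \<subseteq> I ?X ?Y"
      using tri[of ?X ?Z ?Y] comm[OF good good, of z y] by simp
    then have "I ?X ?Z \<subseteq> I ?X ?Y \<or> I ?Y ?Z \<subseteq> I ?X ?Y" using chain by blast
    then have "D (I ?X ?Y) \<le> D (I ?X ?Z) \<or> D (I ?X ?Y) \<le> D (I ?Y ?Z)" using mono by blast
    then show ?thesis
      unfolding dist_rep using nonneg[of "I ?X ?Z"] nonneg[of "I ?Y ?Z"] by linarith
  qed
qed (simp_all add: uniformity_rgraph_def open_rgraph_def)

end

lemma iso_adj_iff:
  assumes "is_rooted_iso f X Y" "u \<in> verts (fst X)" "v \<in> verts (fst X)"
  shows "(f u, f v) \<in> adj (fst Y) \<longleftrightarrow> (u, v) \<in> adj (fst X)"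
  using assms by (simp add: is_rooted_iso_def adj_def)

lemma iso_degree:
  assumes f: "is_rooted_iso f X Y" and X: "multigraph (fst X)" and Y: "multigraph (fst Y)"
    and v: "v \<in> verts (fst X)"
  shows "gdegree (fst Y) (f v) = gdegree (fst X) v"
proof -
  have b: "bij_betw f (verts (fst X)) (verts (fst Y))"
    using f by (simp add: is_rooted_iso_def)
  have "{w. (f v, w) \<in> adj (fst Y)} = f ` {w. (v, w) \<in> adj (fst X)}"
  proof
    show "f ` {w. (v, w) \<in> adj (fst X)} \<subseteq> {w. (f v, w) \<in> adj (fst Y)}"
      using iso_adj_iff[OF f v] adj_verts[OF X] by auto
    show "{w. (f v, w) \<in> adj (fst Y)} \<subseteq> f ` {w. (v, w) \<in> adj (fst X)}"
    proof
      fix w assume w: "w \<in> {w. (f v, w) \<in> adj (fst Y)}"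
      then have "w \<in> verts (fst Y)" using adj_verts[OF Y] by blast
      then obtain u where "u \<in> verts (fst X)" "w = f u"
        using b by (auto simp: bij_betw_def)
      then show "w \<in> f ` {w. (v, w) \<in> adj (fst X)}"
        using w iso_adj_iff[OF f v] by auto
    qed
  qed
  moreover have "inj_on f {w. (v, w) \<in> adj (fst X)}"
    using b adj_verts[OF X] by (auto simp: bij_betw_def intro: inj_on_subset)
  ultimately have "(\<Sum>w | (f v, w) \<in> adj (fst Y). mult (fst Y) (f v) w)
      = (\<Sum>w | (v, w) \<in> adj (fst X). mult (fst Y) (f v) (f w))"
    by (simp add: sum.reindex)
  also have "\<dots> = (\<Sum>w | (v, w) \<in> adj (fst X). mult (fst X) v w)"
    using f v adj_verts[OF X] by (intro sum.cong) (auto simp: is_rooted_iso_def)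
  finally show ?thesis
    using f v by (simp add: gdegree_def is_rooted_iso_def)
qed

lemma iso_is_tree:
  assumes f: "is_rooted_iso f X Y" and X: "good_rooted X" and Y: "good_rooted Y"
    and t: "is_tree (fst Y)"
  shows "is_tree (fst X)"
proof -
  have mX: "multigraph (fst X)" and mY: "multigraph (fst Y)" and cX: "connected_graph (fst X)"
    using X Y by (auto simp: good_rooted_def)
  have b: "bij_betw f (verts (fst X)) (verts (fst Y))"
    and m: "\<And>u v. u \<in> verts (fst X) \<Longrightarrow> v \<in> verts (fst X) \<Longrightarrow>
      mult (fst Y) (f u) (f v) = mult (fst X) u v"
    using f by (auto simp: is_rooted_iso_def)
  have sY: "mult (fst Y) u u = 0" "mult (fst Y) u v \<le> 1" for u v
    using t by (auto simp: is_tree_def simple_graph_def loop_free_def)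
  have "mult (fst X) u u = 0" for u
    using m[of u u] sY(1)[of "f u"] mX by (cases "u \<in> verts (fst X)") (auto simp: multigraph_def)
  moreover have "mult (fst X) u v \<le> 1" for u v
    using m[of u v] sY(2)[of "f u" "f v"] mX unfolding multigraph_def
    by (metis gr0I zero_le)
  ultimately have s: "simple_graph (fst X)"
    by (simp add: simple_graph_def loop_free_def)
  have False if c: "length c \<ge> 3" "distinct c"
    "\<forall>l<length c. (c ! l, c ! (Suc l mod length c)) \<in> adj (fst X)" for c
  proof -
    have sub: "set c \<subseteq> verts (fst X)"
      using c(3) adj_verts[OF mX] by (metis in_set_conv_nth subsetI)
    have len: "length c > 0" using c(1) by linarith
    have "distinct (map f c)"
      using c(2) b sub by (auto simp: distinct_map bij_betw_def intro: inj_on_subset)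
    moreover have "(map f c ! l, map f c ! (Suc l mod length c)) \<in> adj (fst Y)"
      if l: "l < length c" for l
    proof -
      have l': "Suc l mod length c < length c" using len by simp
      have "c ! l \<in> verts (fst X)" "c ! (Suc l mod length c) \<in> verts (fst X)"
        using sub l l' nth_mem by blast+
      then show ?thesis using iso_adj_iff[OF f] c(3) l l' by simp
    qed
    moreover have "\<not> (\<exists>c. length c \<ge> 3 \<and> distinct c
            \<and> (\<forall>l<length c. (c ! l, c ! (Suc l mod length c)) \<in> adj (fst Y)))"
      using t unfolding is_tree_def by blast
    ultimately show False
      using c(1) by (metis length_map)
  qed
  with s cX show ?thesis unfolding is_tree_def by blast
qed

lemma iso_offspring:
  assumes f: "is_rooted_iso f X Y" and X: "good_rooted X" and Y: "good_rooted Y"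
    and h: "\<forall>v\<in>verts (fst Y). offspring (fst Y) (snd Y) v \<noteq> {}"
  shows "\<forall>v\<in>verts (fst X). offspring (fst X) (snd X) v \<noteq> {}"
proof
  fix v assume v: "v \<in> verts (fst X)"
  have mX: "multigraph (fst X)" and mY: "multigraph (fst Y)" and rX: "snd X \<in> verts (fst X)"
    using X Y by (auto simp: good_rooted_def)
  have b: "bij_betw f (verts (fst X)) (verts (fst Y))" and r: "f (snd X) = snd Y"
    using f by (auto simp: is_rooted_iso_def)
  have "f v \<in> verts (fst Y)" using b v by (simp add: bij_betw_apply)
  then obtain w where w: "(f v, w) \<in> adj (fst Y)"
    "gdist (fst Y) (snd Y) w = gdist (fst Y) (snd Y) (f v) + 1"
    using h by (auto simp: offspring_def)
  then have "w \<in> f ` verts (fst X)"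
    using adj_verts[OF mY] b by (auto simp: bij_betw_def)
  then obtain u where u: "u \<in> verts (fst X)" "w = f u" by blast
  have "(v, u) \<in> adj (fst X)" using iso_adj_iff[OF f v u(1)] w u by simp
  moreover have "gdist (fst X) (snd X) u = gdist (fst X) (snd X) v + 1"
    using iso_gdist[OF f mX mY rX rX u(1)] iso_gdist[OF f mX mY rX rX v] w u r by simp
  ultimately show "offspring (fst X) (snd X) v \<noteq> {}" by (auto simp: offspring_def)
qed

lemma rgraph_relE:
  assumes "rgraph_rel X Y"
  obtains f g where "good_rooted X" "good_rooted Y" "is_rooted_iso f X Y" "is_rooted_iso g Y X"
proof -
  obtain f where f: "good_rooted X" "good_rooted Y" "is_rooted_iso f X Y"
    using assms unfolding rgraph_rel_def rooted_isomorphic_def by blast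
  moreover have "is_rooted_iso (inv_into (verts (fst X)) f) Y X"
    by (rule is_rooted_iso_inv[OF f(3)]) (use f(1) in \<open>simp add: good_rooted_def\<close>)
  ultimately show thesis by (rule that)
qed

lift_definition root_degree :: "rgraph \<Rightarrow> nat" is "\<lambda>X. gdegree (fst X) (snd X)"
proof (erule rgraph_relE)
  fix X Y :: "nat mgraph \<times> nat" and f g
  assume X: "good_rooted X" and Y: "good_rooted Y" and f: "is_rooted_iso f X Y"
  have "gdegree (fst Y) (f (snd X)) = gdegree (fst X) (snd X)"
    by (rule iso_degree[OF f]) (use X Y in \<open>simp_all add: good_rooted_def\<close>)
  then show "gdegree (fst X) (snd X) = gdegree (fst Y) (snd Y)"
    using f by (simp add: is_rooted_iso_def)
qed

lift_definition tree_rgraph :: "rgraph \<Rightarrow> bool" is "\<lambda>X. is_tree (fst X)"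
proof (erule rgraph_relE)
  fix X Y :: "nat mgraph \<times> nat" and f g
  assume a: "good_rooted X" "good_rooted Y" and f: "is_rooted_iso f X Y"
    and g: "is_rooted_iso g Y X"
  show "is_tree (fst X) = is_tree (fst Y)"
    using iso_is_tree[OF f a] iso_is_tree[OF g a(2,1)] by (rule iffI[rotated])
qed

lift_definition infinite_rgraph :: "rgraph \<Rightarrow> bool" is "\<lambda>X. infinite (verts (fst X))"
proof (erule rgraph_relE)
  fix X Y :: "nat mgraph \<times> nat" and f g
  assume "is_rooted_iso f X Y"
  then have "bij_betw f (verts (fst X)) (verts (fst Y))" by (simp add: is_rooted_iso_def)
  then show "infinite (verts (fst X)) = infinite (verts (fst Y))" by (simp add: bij_betw_finite)
qed

lift_definition nontrivial_rgraph :: "rgraph \<Rightarrow> bool" is "\<lambda>X. verts (fst X) \<noteq> {snd X}"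
proof (erule rgraph_relE)
  have *: "verts (fst Y) = {snd Y}" if "is_rooted_iso f X Y" "verts (fst X) = {snd X}"
    for f and X Y :: "nat mgraph \<times> nat"
    using that by (auto simp: is_rooted_iso_def bij_betw_def)
  fix X Y :: "nat mgraph \<times> nat" and f g
  assume "is_rooted_iso f X Y" "is_rooted_iso g Y X"
  then show "(verts (fst X) \<noteq> {snd X}) = (verts (fst Y) \<noteq> {snd Y})" using * by metis
qed

lift_definition all_have_offspring :: "rgraph \<Rightarrow> bool" is
  "\<lambda>X. \<forall>v\<in>verts (fst X). offspring (fst X) (snd X) v \<noteq> {}"
proof (erule rgraph_relE)
  fix X Y :: "nat mgraph \<times> nat" and f g
  assume a: "good_rooted X" "good_rooted Y" and f: "is_rooted_iso f X Y"
    and g: "is_rooted_iso g Y X"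
  show "(\<forall>v\<in>verts (fst X). offspring (fst X) (snd X) v \<noteq> {})
      = (\<forall>v\<in>verts (fst Y). offspring (fst Y) (snd Y) v \<noteq> {})"
    using iso_offspring[OF f a] iso_offspring[OF g a(2,1)] by (rule iffI[rotated])
qed

definition component_class :: "nat mgraph \<Rightarrow> nat \<Rightarrow> rgraph" where
  "component_class G i = abs_rgraph (graph_component G i, i)"

lemma good_component:
  assumes G: "multigraph G" "locally_finite G" and i: "i \<in> verts G"
  shows "good_rooted (graph_component G i, i)"
proof -
  let ?H = "graph_component G i" and ?S = "{w. (i, w) \<in> (adj G)\<^sup>*}"
  have sub: "adj ?H \<subseteq> adj G"
    by (auto simp: graph_component_def induced_subgraph_def adj_def split: if_splits)
  have reach: "(i, w) \<in> (adj ?H)\<^sup>*" if "(i, w) \<in> (adj G)\<^sup>*" for w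
    using that
  proof (induction rule: rtrancl_induct)
    case (step y z)
    then have "(y, z) \<in> adj ?H"
      by (auto simp: graph_component_def induced_subgraph_def adj_def
          intro: rtrancl_into_rtrancl)
    with step.IH show ?case by (rule rtrancl_into_rtrancl)
  qed simp
  have m: "multigraph ?H"
    unfolding graph_component_def by (rule multigraph_induced[OF G(1)])
  then have "sym (adj ?H)" by (auto simp: sym_def adj_def multigraph_def)
  then have symr: "sym ((adj ?H)\<^sup>*)" by (rule sym_rtrancl)
  have "connected_graph ?H"
    unfolding connected_graph_def
  proof (intro ballI)
    fix u v assume "u \<in> verts ?H" "v \<in> verts ?H"
    then have "(i, u) \<in> (adj ?H)\<^sup>*" "(i, v) \<in> (adj ?H)\<^sup>*"
      using reach by (auto simp: graph_component_def induced_subgraph_def)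
    then show "(u, v) \<in> (adj ?H)\<^sup>*" using symr by (meson rtrancl_trans symD)
  qed
  moreover have "locally_finite ?H"
    unfolding locally_finite_def
  proof
    fix v assume "v \<in> verts ?H"
    then have "finite {w. (v, w) \<in> adj G}"
      using G(2) by (auto simp: locally_finite_def graph_component_def induced_subgraph_def)
    then show "finite {w. (v, w) \<in> adj ?H}" by (rule finite_subset[rotated]) (use sub in auto)
  qed
  moreover have "i \<in> verts ?H" using i by (simp add: graph_component_def induced_subgraph_def)
  ultimately show ?thesis using m by (simp add: good_rooted_def)
qed


section \<open>Stochastic convergence\<close>

text \<open>Measurability is part of the definition because \<open>measure\<close> is \<open>0\<close> on non-measurable sets.
  It is asked for eventually only, as sequences need not be meaningful for small indices.\<close>

definition conv_in_prob ::
  "(nat \<Rightarrow> 'w measure) \<Rightarrow> (nat \<Rightarrow> 'w \<Rightarrow> real) \<Rightarrow> real \<Rightarrow> bool" where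
  "conv_in_prob M X c \<longleftrightarrow> (\<forall>\<^sub>F n in sequentially. X n \<in> borel_measurable (M n))
     \<and> (\<forall>\<epsilon>>0. (\<lambda>n. measure (M n) {\<omega> \<in> space (M n). \<bar>X n \<omega> - c\<bar> > \<epsilon>}) \<longlonglongrightarrow> 0)"

definition weak_conv_in_prob ::
  "(nat \<Rightarrow> 'w measure) \<Rightarrow> (nat \<Rightarrow> 'w \<Rightarrow> real measure) \<Rightarrow> real measure \<Rightarrow> bool" where
  "weak_conv_in_prob M N L \<longleftrightarrow>
     (\<forall>f. continuous_on UNIV f \<and> bounded (range f) \<longrightarrow>
        conv_in_prob M (\<lambda>n \<omega>. \<integral>x. f x \<partial>N n \<omega>) (\<integral>x. f x \<partial>L))"

definition uniformly_integrable ::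
  "'i set \<Rightarrow> ('i \<Rightarrow> 'w measure) \<Rightarrow> ('i \<Rightarrow> 'w \<Rightarrow> real) \<Rightarrow> bool" where
  "uniformly_integrable I M X \<longleftrightarrow>
     ((\<lambda>K::real. SUP i\<in>I. \<integral>\<^sup>+\<omega>. ennreal (X i \<omega> * indicator {\<omega>. X i \<omega> > K} \<omega>) \<partial>M i) \<longlongrightarrow> 0) at_top"

text \<open>Since the vertex set is fixed and finite, measurability of a random multigraph amounts to
  measurability of its adjacency numbers.\<close>

definition random_graph :: "'w measure \<Rightarrow> nat \<Rightarrow> ('w \<Rightarrow> nat mgraph) \<Rightarrow> bool" where
  "random_graph M n G \<longleftrightarrow> prob_space M
     \<and> (\<forall>\<omega>\<in>space M. multigraph (G \<omega>) \<and> verts (G \<omega>) = {1..n})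
     \<and> (\<forall>i\<in>{1..n}. \<forall>j\<in>{1..n}. (\<lambda>\<omega>. mult (G \<omega>) i j) \<in> measurable M (count_space UNIV))"

definition local_conv_in_prob ::
  "(nat \<Rightarrow> 'w measure) \<Rightarrow> (nat \<Rightarrow> 'w \<Rightarrow> nat mgraph) \<Rightarrow> rgraph measure \<Rightarrow> bool" where
  "local_conv_in_prob M G \<Lambda> \<longleftrightarrow>
     (\<forall>h :: rgraph \<Rightarrow> real. continuous_on UNIV h \<and> bounded (range h) \<longrightarrow>
        conv_in_prob M (\<lambda>n \<omega>. (\<Sum>i\<in>{1..n}. h (component_class (G n \<omega>) i)) / real n)
          (\<integral>H. h H \<partial>\<Lambda>))"


section \<open>Non-negative matrices over a finite index set\<close>

fun mat_pow :: "'a set \<Rightarrow> ('a \<Rightarrow> 'a \<Rightarrow> real) \<Rightarrow> nat \<Rightarrow> 'a \<Rightarrow> 'a \<Rightarrow> real" where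
  "mat_pow S P 0 = (\<lambda>x y. if x = y then 1 else 0)"
| "mat_pow S P (Suc k) = (\<lambda>x y. \<Sum>z\<in>S. P x z * mat_pow S P k z y)"

definition irreducible_on :: "'a set \<Rightarrow> ('a \<Rightarrow> 'a \<Rightarrow> real) \<Rightarrow> bool" where
  "irreducible_on S P \<longleftrightarrow> (\<forall>x\<in>S. \<forall>y\<in>S. \<exists>k. mat_pow S P k x y > 0)"

definition aperiodic_on :: "'a set \<Rightarrow> ('a \<Rightarrow> 'a \<Rightarrow> real) \<Rightarrow> bool" where
  "aperiodic_on S P \<longleftrightarrow> (\<forall>x\<in>S. Gcd {k. k \<ge> 1 \<and> mat_pow S P k x x > 0} = 1)"


section \<open>Explorations and friendship bias\<close>

datatype exploration = Non_Backtracking | Backtracking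

fun min_size :: "exploration \<Rightarrow> nat" where
  "min_size Non_Backtracking = 3"
| "min_size Backtracking = 2"

fun admissible :: "exploration \<Rightarrow> 'v mgraph \<Rightarrow> bool" where
  "admissible Non_Backtracking G \<longleftrightarrow> simple_graph G \<and> (\<forall>i\<in>verts G. gdegree G i \<ge> 2)"
| "admissible Backtracking G \<longleftrightarrow> loop_free G \<and> (\<forall>i\<in>verts G. gdegree G i > 0)"

definition nb_walks :: "'v mgraph \<Rightarrow> nat \<Rightarrow> 'v \<Rightarrow> 'v \<Rightarrow> (nat \<Rightarrow> 'v) set" where
  "nb_walks G k i j = {w \<in> {0..k} \<rightarrow>\<^sub>E verts G. w 0 = i \<and> w k = j
     \<and> (\<forall>l<k. (w l, w (l + 1)) \<in> adj G) \<and> (\<forall>l\<in>{1..<k}. w (l - 1) \<noteq> w (l + 1))}"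

text \<open>Meant for \<open>k \<ge> 1\<close>; in the non-backtracking case the value at \<open>k = 0\<close> is not a probability.\<close>

fun exploration_prob :: "exploration \<Rightarrow> nat \<Rightarrow> 'v mgraph \<Rightarrow> 'v \<Rightarrow> 'v \<Rightarrow> real" where
  "exploration_prob Non_Backtracking k G i j =
     (\<Sum>w\<in>nb_walks G k i j.
        1 / (real (gdegree G i) * (\<Prod>l\<in>{1..<k}. real (gdegree G (w l)) - 1)))"
| "exploration_prob Backtracking k G i j =
     mat_pow (verts G) (\<lambda>u v. real (mult G u v) / real (gdegree G u)) k i j"

text \<open>For a simple graph, the directed edges are exactly the pairs of adjacent vertices.\<close>

definition nb_matrix :: "'v mgraph \<Rightarrow> 'v \<times> 'v \<Rightarrow> 'v \<times> 'v \<Rightarrow> real" where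
  "nb_matrix G e f = (if snd e = fst f \<and> fst e \<noteq> snd f
     then 1 / (real (gdegree G (snd e)) - 1) else 0)"

fun ergodic_exploration :: "exploration \<Rightarrow> 'v mgraph \<Rightarrow> bool" where
  "ergodic_exploration Non_Backtracking G \<longleftrightarrow>
     irreducible_on (adj G) (nb_matrix G) \<and> aperiodic_on (adj G) (nb_matrix G)"
| "ergodic_exploration Backtracking G \<longleftrightarrow> connected_graph G \<and> \<not> bipartite G"

fun limit_tree :: "exploration \<Rightarrow> rgraph \<Rightarrow> bool" where
  "limit_tree Non_Backtracking H \<longleftrightarrow>
     tree_rgraph H \<and> infinite_rgraph H \<and> all_have_offspring H"
| "limit_tree Backtracking H \<longleftrightarrow> tree_rgraph H \<and> nontrivial_rgraph H"

definition friendship_bias :: "exploration \<Rightarrow> nat \<Rightarrow> 'v mgraph \<Rightarrow> 'v \<Rightarrow> real" where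
  "friendship_bias e k G i =
     (\<Sum>j\<in>verts G. exploration_prob e k G i j * real (gdegree G j)) - real (gdegree G i)"

definition stationary_prob :: "'v mgraph \<Rightarrow> 'v \<Rightarrow> real" where
  "stationary_prob G j = real (gdegree G j) / (\<Sum>l\<in>verts G. real (gdegree G l))"

definition stationary_bias :: "'v mgraph \<Rightarrow> 'v \<Rightarrow> real" where
  "stationary_bias G i =
     (\<Sum>j\<in>verts G. stationary_prob G j * real (gdegree G j)) - real (gdegree G i)"

definition empirical_measure :: "'v set \<Rightarrow> ('v \<Rightarrow> real) \<Rightarrow> real measure" where
  "empirical_measure V x = distr (uniform_count_measure V) borel x"

lemma emeasure_empirical_measure:
  assumes "finite V" "V \<noteq> {}" "B \<in> sets borel"
  shows "emeasure (empirical_measure V x) B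
    = ennreal (1 / real (card V)) * (\<Sum>i\<in>V. emeasure (return borel (x i)) B)"
proof -
  have "emeasure (empirical_measure V x) B = emeasure (uniform_count_measure V) (x -` B \<inter> V)"
    using assms by (simp add: empirical_measure_def emeasure_distr space_uniform_count_measure
        measurable_def sets_uniform_count_measure)
  also have "\<dots> = ennreal (real (card (x -` B \<inter> V)) / real (card V))"
    using assms by (subst emeasure_uniform_count_measure) auto
  also have "real (card (x -` B \<inter> V)) = (\<Sum>i\<in>V. indicator B (x i))"
    using assms by (simp add: indicator_def sum.If_cases Int_def vimage_def conj_commute)
  also have "ennreal (\<dots> / real (card V)) = ennreal (1 / real (card V)) * ennreal (\<Sum>i\<in>V. indicator B (x i))"
    by (subst ennreal_mult'[symmetric]) (auto intro!: sum_nonneg)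
  also have "ennreal (\<Sum>i\<in>V. indicator B (x i)) = (\<Sum>i\<in>V. emeasure (return borel (x i)) B)"
    using assms by (subst sum_ennreal[symmetric]) (auto simp: ennreal_indicator)
  finally show ?thesis .
qed

definition bias_measure :: "exploration \<Rightarrow> nat \<Rightarrow> 'v mgraph \<Rightarrow> real measure" where
  "bias_measure e k G = empirical_measure (verts G) (friendship_bias e k G)"

definition stationary_bias_measure :: "'v mgraph \<Rightarrow> real measure" where
  "stationary_bias_measure G = empirical_measure (verts G) (stationary_bias G)"

definition limit_law :: "rgraph measure \<Rightarrow> real measure" where
  "limit_law \<Lambda> =
     (let m1 = \<integral>H. real (root_degree H) \<partial>\<Lambda>; m2 = \<integral>H. (real (root_degree H))\<^sup>2 \<partial>\<Lambda>
      in distr \<Lambda> borel (\<lambda>H. m2 / m1 - real (root_degree H)))"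

end

theory Submission
  imports Defs
begin

text \<open>For a fixed graph, the claim is that the \<open>k\<close>-step exploration probabilities converge to \<open>\<pi>\<^sub>n\<close>:
  the biases are then finite sums of convergent sequences, and an empirical measure with finitely
  many convergent atoms converges weakly. Both explorations come from finite Markov chains. The
  backtracking one is the simple random walk, with stationary distribution proportional to the
  degrees; it is irreducible because the graph is connected, and aperiodic because every vertex has
  a return in two steps and, by non-bipartiteness, a closed walk of odd length. The non-backtracking
  one is a chain on directed edges whose matrix is doubly stochastic, so its stationary
  distribution is uniform; started from a uniform edge out of \<open>i\<close>, its head after \<open>k - 1\<close> steps has
  the law \<open>P\<^sub>n\<^sup>(\<^sup>k\<^sup>)(i, \<cdot>)\<close>, and a uniform directed edge has a head distributed as \<open>\<pi>\<^sub>n\<close>. In both cases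
  convergence is \<open>mat_pow_tendsto_stationary\<close>: irreducibility and aperiodicity make some power of
  the matrix strictly positive (\<open>primitive\<close>), and such a power is a contraction.

  For growing graphs, the stationary bias of \<open>i\<close> is \<open>R\<^sub>n - d\<^sub>i\<close>, where \<open>R\<^sub>n\<close> is the ratio of the
  empirical second and first moments of the degrees. The degree of the root is a locally constant
  function on the space of rooted graphs, so local convergence gives convergence in probability of
  the average over \<open>i\<close> of any bounded function of \<open>d\<^sub>i\<close>. Uniform integrability extends this to
  functions bounded by \<open>d\<^sub>i\<^sup>2\<close> (\<open>conv_dominated\<close>), so \<open>R\<^sub>n\<close> converges in probability to
  \<open>m\<^sup>(\<^sup>2\<^sup>) / m\<^sup>(\<^sup>1\<^sup>)\<close>. Finally \<open>R\<^sub>n\<close> may be replaced by this limit inside a continuous test function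
  (\<open>conv_recentred\<close>), because the function is uniformly continuous on bounded sets and, the mean
  degree being bounded in probability, few vertices have a large degree.\<close>

section \<open>Powers of primitive stochastic matrices\<close>

text \<open>The least positive difference \<open>d\<close> of two elements divides every element: a remainder
  modulo \<open>d\<close> is again a difference, hence \<open>0\<close>. So \<open>d = 1\<close>, there are consecutive elements \<open>b\<close> and
  \<open>b + 1\<close>, and these generate all numbers from \<open>b\<^sup>2\<close> on.\<close>

lemma additively_closed_contains_tail:
  fixes A :: "nat set"
  assumes add: "\<And>a b. a \<in> A \<Longrightarrow> b \<in> A \<Longrightarrow> a + b \<in> A"
    and pos: "0 \<notin> A" and gcd: "Gcd A = 1"
  obtains N where "\<And>n. n \<ge> N \<Longrightarrow> n \<in> A"
proof -
  have mult: "q * a \<in> A" if "a \<in> A" "q > 0" for q a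
    using that(2)
  proof (induction q rule: nat_induct_non_zero)
    case (Suc q)
    then show ?case using add[OF that(1)] by simp
  qed (use that in simp)
  define D where "D d \<longleftrightarrow> d > 0 \<and> (\<exists>b\<in>A. b + d \<in> A)" for d
  have "A \<noteq> {}" using gcd by auto
  then obtain a0 where a0: "a0 \<in> A" by blast
  have D_self: "D c" if "c \<in> A" for c
    using that pos add[OF that that] unfolding D_def by (metis gr0I)
  define d where "d = (LEAST d. D d)"
  have d: "D d" unfolding d_def using D_self[OF a0] by (rule LeastI)
  have least: "d \<le> r" if "D r" for r
    unfolding d_def using that by (rule Least_le)
  obtain b where b: "b \<in> A" "b + d \<in> A" "d > 0" using d by (auto simp: D_def)
  have "d dvd c" if c: "c \<in> A" for c
  proof (rule ccontr)
    assume nd: "\<not> d dvd c"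
    define q where "q = c div d"
    define r where "r = c mod d"
    have r: "0 < r" "r < d" using nd b(3) by (auto simp: r_def dvd_eq_mod_eq_0)
    have cq: "c = q * d + r" by (simp add: q_def r_def)
    have "q > 0"
    proof (rule ccontr)
      assume "\<not> q > 0"
      then show False using least[OF D_self[OF c]] r cq by simp
    qed
    then have "q * (b + d) \<in> A" "q * b + c \<in> A"
      using mult[OF b(2)] mult[OF b(1)] add c by blast+
    moreover have "q * b + c = q * (b + d) + r" using cq by (simp add: algebra_simps)
    ultimately have "D r" using r by (auto simp: D_def)
    then show False using least r by fastforce
  qed
  then have "d dvd Gcd A" by (simp add: Gcd_greatest)
  then have "d = 1" using gcd by simp
  with b have b1: "b + 1 \<in> A" by simp
  have "b > 0" using b(1) pos by (cases b) auto
  show thesis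
  proof
    fix n assume n: "n \<ge> b * b"
    define q where "q = n div b"
    define r where "r = n mod b"
    have "r < b" using \<open>b > 0\<close> by (simp add: r_def)
    moreover have "b \<le> q" using n \<open>b > 0\<close> by (simp add: q_def less_eq_div_iff_mult_less_eq)
    ultimately have rq: "r < q" by simp
    have "n = q * b + r" by (simp add: q_def r_def)
    also have "\<dots> = (q - r) * b + r * (b + 1)"
      using rq by (simp add: algebra_simps diff_mult_distrib)
    finally have eq: "n = (q - r) * b + r * (b + 1)" .
    have 1: "(q - r) * b \<in> A" using mult[OF b(1)] rq by simp
    show "n \<in> A"
    proof (cases "r = 0")
      case True
      then show ?thesis using eq 1 by simp
    next
      case False
      then show ?thesis using eq add[OF 1 mult[OF b1]] by simp
    qed
  qed
qed

locale finite_chain =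
  fixes S :: "'a set" and P :: "'a \<Rightarrow> 'a \<Rightarrow> real"
  assumes finite_S: "finite S"
    and nonneg: "\<And>x y. x \<in> S \<Longrightarrow> y \<in> S \<Longrightarrow> P x y \<ge> 0"
    and row_sum: "\<And>x. x \<in> S \<Longrightarrow> (\<Sum>y\<in>S. P x y) = 1"
begin

lemma mat_pow_nonneg: "x \<in> S \<Longrightarrow> y \<in> S \<Longrightarrow> mat_pow S P k x y \<ge> 0"
  by (induction k arbitrary: x) (auto intro!: sum_nonneg mult_nonneg_nonneg nonneg)

lemma mat_pow_row_sum: "x \<in> S \<Longrightarrow> (\<Sum>y\<in>S. mat_pow S P k x y) = 1"
proof (induction k arbitrary: x)
  case 0
  then show ?case using finite_S by simp
next
  case (Suc k)
  have "(\<Sum>y\<in>S. mat_pow S P (Suc k) x y) = (\<Sum>z\<in>S. P x z * (\<Sum>y\<in>S. mat_pow S P k z y))"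
    by (simp add: sum_distrib_left) (rule sum.swap)
  then show ?case using Suc row_sum by simp
qed

lemma mat_pow_le_1: 
  assumes "x \<in> S" "y \<in> S" shows "mat_pow S P k x y \<le> 1"
  using member_le_sum[of y S "mat_pow S P k x"] mat_pow_row_sum[of x k] mat_pow_nonneg assms finite_S
  by simp

lemma mat_pow_add:
  "x \<in> S \<Longrightarrow> mat_pow S P (j + k) x y = (\<Sum>z\<in>S. mat_pow S P j x z * mat_pow S P k z y)"
proof (induction j arbitrary: x)
  case 0
  have "(\<Sum>z\<in>S. (if x = z then 1 else 0) * mat_pow S P k z y)
      = (\<Sum>z\<in>S. if x = z then mat_pow S P k z y else 0)"
    by (rule sum.cong) auto
  then show ?case using 0 finite_S by simp
next
  case (Suc j)
  have "mat_pow S P (Suc j + k) x y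
      = (\<Sum>w\<in>S. P x w * (\<Sum>z\<in>S. mat_pow S P j w z * mat_pow S P k z y))"
    using Suc.IH by simp
  also have "\<dots> = (\<Sum>z\<in>S. \<Sum>w\<in>S. P x w * mat_pow S P j w z * mat_pow S P k z y)"
    by (subst sum.swap) (simp add: sum_distrib_left mult.assoc)
  also have "\<dots> = (\<Sum>z\<in>S. mat_pow S P (Suc j) x z * mat_pow S P k z y)"
    by (simp add: sum_distrib_right)
  finally show ?case .
qed

lemma mat_pow_add_pos:
  assumes "x \<in> S" "y \<in> S" "z \<in> S" "mat_pow S P j x y > 0" "mat_pow S P k y z > 0"
  shows "mat_pow S P (j + k) x z > 0"
proof -
  have "0 < mat_pow S P j x y * mat_pow S P k y z" using assms by simp
  also have "\<dots> \<le> (\<Sum>w\<in>S. mat_pow S P j x w * mat_pow S P k w z)"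
    by (rule member_le_sum) (use assms finite_S mat_pow_nonneg in auto)
  finally show ?thesis using mat_pow_add assms(1) by simp
qed

text \<open>Return times to a state form an additive semigroup with greatest common divisor \<open>1\<close>, so
  all large times are return times; irreducibility carries this over to pairs of states.\<close>

lemma primitive:
  assumes irr: "irreducible_on S P" and aper: "aperiodic_on S P"
  obtains N where "N > 0" "\<And>x y. x \<in> S \<Longrightarrow> y \<in> S \<Longrightarrow> mat_pow S P N x y > 0"
proof -
  have ret: "\<exists>N. \<forall>n\<ge>N. mat_pow S P n x x > 0" if x: "x \<in> S" for x
  proof -
    have "Gcd {k. k \<ge> 1 \<and> mat_pow S P k x x > 0} = 1"
      using aper x by (simp add: aperiodic_on_def)
    from additively_closed_contains_tail[OF _ _ this] show ?thesis
      using mat_pow_add_pos[OF x x x] by simp (metis add_pos_pos less_eq_Suc_le)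
  qed
  have "\<forall>p\<in>S\<times>S. \<exists>N. \<forall>n\<ge>N. mat_pow S P n (fst p) (snd p) > 0"
  proof
    fix p assume p: "p \<in> S \<times> S"
    obtain N where N: "\<forall>n\<ge>N. mat_pow S P n (fst p) (fst p) > 0" using ret p by force
    obtain k where k: "mat_pow S P k (fst p) (snd p) > 0"
      using irr p by (force simp: irreducible_on_def)
    have "mat_pow S P n (fst p) (snd p) > 0" if "n \<ge> N + k" for n
    proof -
      have "mat_pow S P (n - k + k) (fst p) (snd p) > 0"
        by (rule mat_pow_add_pos[of _ "fst p"]) (use p N k that in auto)
      then show ?thesis using that by simp
    qed
    then show "\<exists>N. \<forall>n\<ge>N. mat_pow S P n (fst p) (snd p) > 0" by blast
  qed
  then obtain N where N: "\<And>p n. p \<in> S \<times> S \<Longrightarrow> n \<ge> N p \<Longrightarrow> mat_pow S P n (fst p) (snd p) > 0"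
    by metis
  (* the sum bounds the maximum; Suc only keeps the common time positive *)
  let ?N = "Suc (\<Sum>p\<in>S\<times>S. N p)"
  show thesis
  proof
    fix x y assume xy: "x \<in> S" "y \<in> S"
    have "N (x, y) \<le> (\<Sum>p\<in>S\<times>S. N p)"
      by (rule member_le_sum) (use xy finite_S in auto)
    then show "mat_pow S P ?N x y > 0" using N[of "(x, y)" ?N] xy by simp
  qed simp
qed

text \<open>Doeblin's contraction argument. Write \<open>\<Pi>\<close> for the matrix all of whose rows are \<open>\<pi>\<close>. If \<open>\<delta>\<close> is
  the least entry of \<open>P\<^sup>N\<close>, then \<open>P\<^sup>N \<ge> \<delta> \<Pi>\<close> entrywise, and stationarity gives
  \<open>\<Pi> (P\<^sup>k - \<Pi>) = 0\<close>. Hence, when \<open>P\<^sup>N\<close> is applied to a column of \<open>P\<^sup>k - \<Pi>\<close>, it may be replaced by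
  \<open>P\<^sup>N - \<delta> \<Pi>\<close>, which is non-negative with row sums \<open>1 - \<delta>\<close> and so shrinks the
  supremum norm by the factor \<open>1 - \<delta>\<close>.\<close>

theorem mat_pow_tendsto_stationary:
  assumes irr: "irreducible_on S P" and aper: "aperiodic_on S P"
    and pi_nonneg: "\<And>x. x \<in> S \<Longrightarrow> \<pi> x \<ge> 0" and pi_sum: "(\<Sum>x\<in>S. \<pi> x) = 1"
    and pi_stat: "\<And>y. y \<in> S \<Longrightarrow> (\<Sum>x\<in>S. \<pi> x * P x y) = \<pi> y"
    and x: "x \<in> S" and y: "y \<in> S"
  shows "(\<lambda>k. mat_pow S P k x y) \<longlonglongrightarrow> \<pi> y"
proof -
  obtain N where N: "N > 0" "\<And>x y. x \<in> S \<Longrightarrow> y \<in> S \<Longrightarrow> mat_pow S P N x y > 0"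
    using primitive[OF irr aper] by blast
  have pi_le: "\<pi> z \<le> 1" if "z \<in> S" for z
    using member_le_sum[of z S \<pi>] that pi_nonneg pi_sum finite_S by simp
  have pi_stat_pow: "(\<Sum>x\<in>S. \<pi> x * mat_pow S P k x y) = \<pi> y" for k
  proof (induction k)
    case 0
    have "(\<Sum>x\<in>S. \<pi> x * (if x = y then 1 else 0)) = (\<Sum>x\<in>S. if x = y then \<pi> x else 0)"
      by (rule sum.cong) auto
    then show ?case using y finite_S by simp
  next
    case (Suc k)
    have "(\<Sum>x\<in>S. \<pi> x * mat_pow S P (Suc k) x y)
        = (\<Sum>z\<in>S. \<Sum>x\<in>S. \<pi> x * P x z * mat_pow S P k z y)"
      by (subst sum.swap) (simp add: sum_distrib_left mult.assoc)
    also have "\<dots> = (\<Sum>z\<in>S. \<pi> z * mat_pow S P k z y)"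
      by (rule sum.cong) (simp_all add: sum_distrib_right[symmetric] pi_stat)
    finally show ?case using Suc by simp
  qed
  define \<delta> where "\<delta> = Min ((\<lambda>(x, y). mat_pow S P N x y) ` (S \<times> S))"
  have "S \<times> S \<noteq> {}" using x by auto
  then have \<delta>_pos: "\<delta> > 0"
    unfolding \<delta>_def using N(2) finite_S by (subst Min_gr_iff) auto
  have \<delta>_le: "\<delta> \<le> mat_pow S P N u z" if "u \<in> S" "z \<in> S" for u z
    unfolding \<delta>_def by (rule Min_le) (use that finite_S in auto)
  have \<delta>_1: "\<delta> \<le> 1" using \<delta>_le[OF x y] mat_pow_le_1[OF x y] by (rule order_trans)
  (* the column of index y of P^k minus its claimed limit *)
  define g where "g k u = mat_pow S P k u y - \<pi> y" for k u
  have g_pi: "(\<Sum>z\<in>S. \<pi> z * g k z) = 0" for k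
    by (simp add: g_def right_diff_distrib sum_subtractf pi_stat_pow
        sum_distrib_right[symmetric] pi_sum)
  have g_add: "g (N + k) u = (\<Sum>z\<in>S. (mat_pow S P N u z - \<delta> * \<pi> z) * g k z)" if "u \<in> S" for u k
  proof -
    have "g (N + k) u = (\<Sum>z\<in>S. mat_pow S P N u z * g k z)"
      using that by (simp add: g_def mat_pow_add right_diff_distrib sum_subtractf
          sum_distrib_right[symmetric] mat_pow_row_sum)
    then show ?thesis
      using g_pi[of k] by (simp add: left_diff_distrib sum_subtractf mult.assoc
          sum_distrib_left[symmetric])
  qed
  have bound: "\<bar>g k u\<bar> \<le> (1 - \<delta>) ^ (k div N)" if "u \<in> S" for k u
    using that
  proof (induction k arbitrary: u rule: less_induct)
    case (less k)
    show ?case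
    proof (cases "k < N")
      case True
      have "\<bar>g k u\<bar> \<le> 1"
        using mat_pow_nonneg[OF less.prems y, of k] mat_pow_le_1[OF less.prems y, of k]
          pi_nonneg[OF y] pi_le[OF y]
        by (simp add: g_def)
      then show ?thesis using True by simp
    next
      case False
      have nn: "mat_pow S P N u z - \<delta> * \<pi> z \<ge> 0" if "z \<in> S" for z
        using \<delta>_le[OF less.prems that] \<delta>_pos pi_le[OF that] mult_left_le[of "\<pi> z" \<delta>] by linarith
      have "\<bar>g (N + (k - N)) u\<bar> \<le> (\<Sum>z\<in>S. \<bar>(mat_pow S P N u z - \<delta> * \<pi> z) * g (k - N) z\<bar>)"
        unfolding g_add[OF less.prems] by (rule sum_abs)
      also have "\<dots> \<le> (\<Sum>z\<in>S. (mat_pow S P N u z - \<delta> * \<pi> z) * (1 - \<delta>) ^ ((k - N) div N))"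
      proof (rule sum_mono)
        fix z assume z: "z \<in> S"
        have "\<bar>g (k - N) z\<bar> \<le> (1 - \<delta>) ^ ((k - N) div N)"
          by (rule less.IH) (use False N(1) z in auto)
        then show "\<bar>(mat_pow S P N u z - \<delta> * \<pi> z) * g (k - N) z\<bar>
            \<le> (mat_pow S P N u z - \<delta> * \<pi> z) * (1 - \<delta>) ^ ((k - N) div N)"
          using nn[OF z] by (simp add: abs_mult mult_left_mono)
      qed
      also have "\<dots> = (1 - \<delta>) * (1 - \<delta>) ^ ((k - N) div N)"
        using less.prems by (simp add: sum_distrib_right[symmetric] sum_subtractf mat_pow_row_sum
            sum_distrib_left[symmetric] pi_sum)
      also have "\<dots> = (1 - \<delta>) ^ (k div N)"
        using False N(1) by (simp add: le_div_geq)
      finally show ?thesis using False by simp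
    qed
  qed
  have "filterlim (\<lambda>k. k div N) at_top sequentially"
    unfolding filterlim_at_top
  proof
    fix Z
    show "\<forall>\<^sub>F k in sequentially. Z \<le> k div N"
      using eventually_ge_at_top[of "Z * N"]
      by eventually_elim (use N(1) in \<open>simp add: less_eq_div_iff_mult_less_eq\<close>)
  qed
  moreover have "(\<lambda>m. (1 - \<delta>) ^ m) \<longlonglongrightarrow> 0"
    by (rule LIMSEQ_power_zero) (use \<delta>_pos \<delta>_1 in auto)
  ultimately have "(\<lambda>k. (1 - \<delta>) ^ (k div N)) \<longlonglongrightarrow> 0"
    by (rule filterlim_compose[rotated])
  then have "(\<lambda>k. g k x) \<longlonglongrightarrow> 0"
    by (rule Lim_null_comparison[rotated]) (use bound[OF x] in auto)
  then show ?thesis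
    unfolding g_def using LIM_zero_iff by blast
qed

end

section \<open>Long explorations of a fixed graph\<close>

context finite_chain
begin

lemma mat_pow_pos_iff:
  assumes "x \<in> S" "y \<in> S"
  shows "mat_pow S P k x y > 0 \<longleftrightarrow> (x, y) \<in> {(u, v). u \<in> S \<and> v \<in> S \<and> P u v > 0} ^^ k"
  using assms(1)
proof (induction k arbitrary: x)
  case 0
  then show ?case by simp
next
  case (Suc k)
  let ?R = "{(u, v). u \<in> S \<and> v \<in> S \<and> P u v > 0}"
  have "mat_pow S P (Suc k) x y > 0 \<longleftrightarrow> (\<exists>z\<in>S. P x z * mat_pow S P k z y > 0)"
  proof -
    have nn: "P x z * mat_pow S P k z y \<ge> 0" if "z \<in> S" for z
      using that Suc.prems assms(2) nonneg mat_pow_nonneg by simp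
    have "mat_pow S P (Suc k) x y > 0 \<longleftrightarrow> (\<Sum>z\<in>S. P x z * mat_pow S P k z y) \<noteq> 0"
      using sum_nonneg[of S "\<lambda>z. P x z * mat_pow S P k z y"] nn by (auto simp: less_le)
    then show ?thesis
      using sum_nonneg_eq_0_iff[OF finite_S nn] nn by (auto simp: less_le)
  qed
  also have "\<dots> \<longleftrightarrow> (\<exists>z\<in>S. P x z > 0 \<and> mat_pow S P k z y > 0)"
    using nonneg[OF Suc.prems] mat_pow_nonneg[OF _ assms(2)]
    by (auto simp: zero_less_mult_iff not_less[symmetric])
  also have "\<dots> \<longleftrightarrow> (\<exists>z. (x, z) \<in> ?R \<and> (z, y) \<in> ?R ^^ k)"
    using Suc.IH Suc.prems by blast
  also have "\<dots> \<longleftrightarrow> (x, y) \<in> ?R ^^ Suc k"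
    by (blast intro: relpow_Suc_I2 elim: relpow_Suc_E2)
  finally show ?case .
qed

end

lemma finite_adj: "multigraph G \<Longrightarrow> finite (verts G) \<Longrightarrow> finite (adj G)"
  by (rule finite_subset[of _ "verts G \<times> verts G"]) (auto dest: adj_verts)

lemma gdegree_eq_sum:
  assumes "multigraph G" "finite (verts G)"
  shows "gdegree G i = (\<Sum>j\<in>verts G. mult G i j) + mult G i i"
proof -
  have "(\<Sum>w | (i, w) \<in> adj G. mult G i w) = (\<Sum>j\<in>verts G. mult G i j)"
    using assms by (intro sum.mono_neutral_left) (auto dest: adj_verts simp: adj_def)
  then show ?thesis by (simp add: gdegree_def)
qed

lemma sum_adj:
  fixes h :: "'v \<times> 'v \<Rightarrow> real"
  assumes "multigraph G" "finite (verts G)"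
  shows "(\<Sum>e\<in>adj G. h e) = (\<Sum>a\<in>verts G. \<Sum>b\<in>verts G. if (a, b) \<in> adj G then h (a, b) else 0)"
proof -
  have "(\<Sum>e\<in>adj G. h e) = (\<Sum>e\<in>verts G \<times> verts G. if e \<in> adj G then h e else 0)"
    using assms by (intro sum.mono_neutral_cong_left) (auto dest: adj_verts)
  also have "\<dots> = (\<Sum>(a, b)\<in>verts G \<times> verts G. if (a, b) \<in> adj G then h (a, b) else 0)"
    by (rule sum.cong) auto
  finally show ?thesis by (simp add: sum.cartesian_product)
qed

lemma relpow_sym:
  assumes "sym R" "(x, y) \<in> R ^^ k"
  shows "(y, x) \<in> R ^^ k"
  using assms(2)
proof (induction k arbitrary: y)
  case (Suc k)
  then obtain z where "(x, z) \<in> R ^^ k" "(z, y) \<in> R" by auto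
  then show ?case using Suc.IH assms(1) by (meson relpow_Suc_I2 symD)
qed auto

lemma sym_adj: "multigraph G \<Longrightarrow> sym (adj G)"
  by (auto simp: sym_def adj_def multigraph_def)

text \<open>If no closed walk at \<open>x\<close> had odd length, the vertices at even walking distance from \<open>x\<close>
  would be one side of a bipartition.\<close>

lemma odd_closed_walk:
  assumes G: "multigraph G" "connected_graph G" "\<not> bipartite G" and x: "x \<in> verts G"
  shows "\<exists>k. odd k \<and> (x, x) \<in> adj G ^^ k"
proof (rule ccontr)
  assume "\<not> ?thesis"
  then have even: "even k" if "(x, x) \<in> adj G ^^ k" for k using that by blast
  let ?S = "{v \<in> verts G. \<exists>k. even k \<and> (x, v) \<in> adj G ^^ k}"
  have "u \<in> ?S \<longleftrightarrow> v \<notin> ?S" if uv: "(u, v) \<in> adj G" for u v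
  proof -
    have V: "u \<in> verts G" "v \<in> verts G" using adj_verts[OF G(1) uv] by auto
    have "even (j + 1 + k)" if "(x, u) \<in> adj G ^^ j" "(x, v) \<in> adj G ^^ k" for j k
    proof (rule even)
      have "(x, v) \<in> adj G ^^ Suc j" using that(1) uv by auto
      moreover have "(v, x) \<in> adj G ^^ k" by (rule relpow_sym[OF sym_adj[OF G(1)] that(2)])
      ultimately have "(x, x) \<in> adj G ^^ Suc j O adj G ^^ k" by (rule relcompI)
      then show "(x, x) \<in> adj G ^^ (j + 1 + k)" by (simp only: relpow_add[symmetric] Suc_eq_plus1)
    qed
    then have *: "(odd j \<longleftrightarrow> even k)" if "(x, u) \<in> adj G ^^ j" "(x, v) \<in> adj G ^^ k" for j k
      using \<open>\<And>k j. \<lbrakk>(x, u) \<in> adj G ^^ j; (x, v) \<in> adj G ^^ k\<rbrakk> \<Longrightarrow> even (j + 1 + k)\<close>[OF that] by simp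
    obtain j k where "(x, u) \<in> adj G ^^ j" "(x, v) \<in> adj G ^^ k"
      using G(2) x V by (meson connected_graph_def rtrancl_imp_relpow)
    then show ?thesis using *[of j] *[of _ k] V by blast
  qed
  then have "bipartite G" unfolding bipartite_def by (intro exI[of _ ?S]) blast
  with G(3) show False by contradiction
qed

text \<open>The simple random walk is reversible with respect to the degrees. Stepping to a neighbour and
  back is a return in two steps, which together with an odd closed walk makes the period \<open>1\<close>.\<close>

lemma backtracking_prob_tendsto:
  assumes G: "multigraph G" "finite (verts G)" and adm: "admissible Backtracking G"
    and erg: "ergodic_exploration Backtracking G"
    and i: "i \<in> verts G" and j: "j \<in> verts G"
  shows "(\<lambda>k. exploration_prob Backtracking k G i j) \<longlonglongrightarrow> stationary_prob G j"
proof -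
  let ?V = "verts G" and ?P = "\<lambda>u v. real (mult G u v) / real (gdegree G u)"
  have loop: "mult G u u = 0" for u using adm by (simp add: loop_free_def)
  have deg: "real (gdegree G u) = (\<Sum>v\<in>?V. real (mult G u v))" for u
    using gdegree_eq_sum[OF G, of u] loop by simp
  have pos: "gdegree G u > 0" if "u \<in> ?V" for u using adm that by simp
  interpret finite_chain ?V ?P
  proof
    fix x assume "x \<in> ?V"
    then show "(\<Sum>y\<in>?V. ?P x y) = 1"
      using deg[of x] pos[of x] by (simp add: sum_divide_distrib[symmetric])
  qed (use G in auto)
  have adj_eq: "{(u, v). u \<in> ?V \<and> v \<in> ?V \<and> ?P u v > 0} = adj G"
    using pos adj_verts[OF G(1)] by (auto simp: adj_def zero_less_divide_iff)
  have walk: "mat_pow ?V ?P k x y > 0 \<longleftrightarrow> (x, y) \<in> adj G ^^ k" if "x \<in> ?V" "y \<in> ?V" for x y k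
    using mat_pow_pos_iff[OF that] adj_eq by simp
  have irr: "irreducible_on ?V ?P"
    unfolding irreducible_on_def
    using erg by (auto simp: walk connected_graph_def intro: rtrancl_imp_relpow)
  have aper: "aperiodic_on ?V ?P"
    unfolding aperiodic_on_def
  proof
    fix x assume x: "x \<in> ?V"
    let ?K = "{k. k \<ge> 1 \<and> mat_pow ?V ?P k x x > 0}"
    obtain k where k: "odd k" "(x, x) \<in> adj G ^^ k"
      using odd_closed_walk[OF G(1) _ _ x] erg unfolding ergodic_exploration.simps by blast
    have "\<exists>w\<in>?V. mult G x w \<noteq> 0"
      using pos[OF x] deg[of x] by (metis gr_implies_not0 of_nat_0 of_nat_eq_0_iff sum.neutral)
    then obtain w where "(x, w) \<in> adj G" by (auto simp: adj_def)
    then have "(x, x) \<in> adj G ^^ 2"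
      using sym_adj[OF G(1)] by (auto simp: numeral_2_eq_2 dest: symD)
    then have "2 \<in> ?K" using walk[OF x x, of 2] by simp
    moreover have "k \<in> ?K" using k walk[OF x x, of k] odd_pos[OF k(1)] by simp
    ultimately have "Gcd ?K dvd gcd 2 k" by (intro gcd_greatest Gcd_dvd)
    also have "gcd 2 k = 1" using k(1) by (simp add: coprime_left_2_iff_odd flip: coprime_iff_gcd_eq_1)
    finally show "Gcd ?K = 1" by simp
  qed
  have D: "(\<Sum>l\<in>?V. real (gdegree G l)) > 0"
    by (rule sum_pos) (use G i pos in auto)
  have "(\<lambda>k. mat_pow ?V ?P k i j) \<longlonglongrightarrow> stationary_prob G j"
  proof (rule mat_pow_tendsto_stationary[OF irr aper _ _ _ i j])
    show "(\<Sum>x\<in>?V. stationary_prob G x) = 1"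
      using D by (simp add: stationary_prob_def sum_divide_distrib[symmetric])
    fix y assume "y \<in> ?V"
    have "(\<Sum>x\<in>?V. stationary_prob G x * ?P x y)
        = (\<Sum>x\<in>?V. real (mult G y x) / (\<Sum>l\<in>?V. real (gdegree G l)))"
    proof (rule sum.cong)
      fix x assume "x \<in> ?V"
      then show "stationary_prob G x * ?P x y = real (mult G y x) / (\<Sum>l\<in>?V. real (gdegree G l))"
        using pos[of x] multigraph_sym[OF G(1), of x y] by (simp add: stationary_prob_def)
    qed simp
    also have "\<dots> = stationary_prob G y"
      by (simp add: stationary_prob_def sum_divide_distrib[symmetric] deg[of y])
    finally show "(\<Sum>x\<in>?V. stationary_prob G x * ?P x y) = stationary_prob G y" .
  qed (auto simp: stationary_prob_def intro!: divide_nonneg_nonneg sum_nonneg)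
  then show ?thesis by simp
qed

lemma sum_PiE_Suc:
  fixes g :: "(nat \<Rightarrow> 'v) \<Rightarrow> real"
  shows "(\<Sum>w\<in>{0..Suc k} \<rightarrow>\<^sub>E V. g w) = (\<Sum>w\<in>{0..k} \<rightarrow>\<^sub>E V. \<Sum>c\<in>V. g (w(Suc k := c)))"
proof -
  have "{0..Suc k} \<rightarrow>\<^sub>E V = (\<lambda>(c, w). w(Suc k := c)) ` (V \<times> ({0..k} \<rightarrow>\<^sub>E V))"
    by (subst PiE_insert_eq[symmetric]) (simp add: atLeast0_atMost_Suc)
  moreover have "inj_on (\<lambda>(c, w). w(Suc k := c)) (V \<times> ({0..k} \<rightarrow>\<^sub>E V))"
    by (rule inj_combinator) simp
  ultimately have "(\<Sum>w\<in>{0..Suc k} \<rightarrow>\<^sub>E V. g w) = (\<Sum>(c, w)\<in>V \<times> ({0..k} \<rightarrow>\<^sub>E V). g (w(Suc k := c)))"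
    by (simp add: sum.reindex case_prod_unfold)
  also have "\<dots> = (\<Sum>w\<in>{0..k} \<rightarrow>\<^sub>E V. \<Sum>c\<in>V. g (w(Suc k := c)))"
    by (subst sum.swap) (simp add: sum.cartesian_product)
  finally show ?thesis .
qed

lemma sum_PiE_0:
  fixes g :: "(nat \<Rightarrow> 'v) \<Rightarrow> real"
  shows "(\<Sum>w\<in>{0..0} \<rightarrow>\<^sub>E V. g w) = (\<Sum>c\<in>V. g ((\<lambda>_. undefined)(0 := c)))"
proof -
  have inj: "inj_on (\<lambda>c. (\<lambda>_. undefined)(0 := c)) V"
    by (rule inj_onI) (metis fun_upd_same)
  have "{0..0::nat} \<rightarrow>\<^sub>E V = (\<lambda>c. (\<lambda>_. undefined)(0 := c)) ` V"
    using PiE_insert_eq[of "0 :: nat" "{}" "\<lambda>_. V"] by (auto simp: image_iff)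
  then show ?thesis by (simp only: sum.reindex[OF inj] o_def)
qed

text \<open>This is the probability of the walk given its first step, extended by zero to all functions
  \<open>w\<close>, so that the sum over walks becomes a sum over a product set. Without the factor \<open>1 / d\<^sub>i\<close> of
  the first step, the weight is multiplied by an entry of \<open>nb_matrix G\<close> whenever a walk of at least
  one step is extended by a step.\<close>

definition nb_weight :: "'v mgraph \<Rightarrow> 'v \<Rightarrow> nat \<Rightarrow> (nat \<Rightarrow> 'v) \<Rightarrow> real" where
  "nb_weight G i k w =
     (if w 0 = i \<and> (\<forall>l<k. (w l, w (l + 1)) \<in> adj G) \<and> (\<forall>l\<in>{1..<k}. w (l - 1) \<noteq> w (l + 1))
      then 1 / (\<Prod>l\<in>{1..<k}. real (gdegree G (w l)) - 1) else 0)"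

lemma nb_weight_extend:
  "nb_weight G i (Suc (Suc k)) (w(Suc (Suc k) := c))
    = nb_weight G i (Suc k) w
      * (if (w (Suc k), c) \<in> adj G then nb_matrix G (w k, w (Suc k)) (w (Suc k), c) else 0)"
proof -
  let ?w = "w(Suc (Suc k) := c)"
  have old: "?w l = w l" if "l \<le> Suc k" for l using that by simp
  have "(\<forall>l<Suc (Suc k). (?w l, ?w (l + 1)) \<in> adj G)
      \<longleftrightarrow> (\<forall>l<Suc k. (?w l, ?w (l + 1)) \<in> adj G) \<and> (?w (Suc k), ?w (Suc k + 1)) \<in> adj G"
    by (subst All_less_Suc) blast
  then have 1: "(\<forall>l<Suc (Suc k). (?w l, ?w (l + 1)) \<in> adj G)
      \<longleftrightarrow> (\<forall>l<Suc k. (w l, w (l + 1)) \<in> adj G) \<and> (w (Suc k), c) \<in> adj G"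
    by (simp add: old cong: conj_cong)
  have set: "{1..<Suc (Suc k)} = insert (Suc k) {1..<Suc k}" by auto
  have ins: "(\<forall>l\<in>insert a B. Q l) \<longleftrightarrow> (\<forall>l\<in>B. Q l) \<and> Q a" for Q and a :: nat and B
    by blast
  have "(\<forall>l\<in>{1..<Suc (Suc k)}. ?w (l - 1) \<noteq> ?w (l + 1))
      \<longleftrightarrow> (\<forall>l\<in>{1..<Suc k}. ?w (l - 1) \<noteq> ?w (l + 1)) \<and> ?w k \<noteq> ?w (Suc k + 1)"
    unfolding set ins diff_Suc_1 by (rule refl)
  moreover have "(\<forall>l\<in>{1..<Suc k}. ?w (l - 1) \<noteq> ?w (l + 1))
      \<longleftrightarrow> (\<forall>l\<in>{1..<Suc k}. w (l - 1) \<noteq> w (l + 1))"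
    by (rule ball_cong) auto
  moreover have "?w k = w k" "?w (Suc k + 1) = c" by simp_all
  ultimately have 2: "(\<forall>l\<in>{1..<Suc (Suc k)}. ?w (l - 1) \<noteq> ?w (l + 1))
      \<longleftrightarrow> (\<forall>l\<in>{1..<Suc k}. w (l - 1) \<noteq> w (l + 1)) \<and> w k \<noteq> c"
    by (simp only:)
  have 3: "(\<Prod>l\<in>{1..<Suc (Suc k)}. real (gdegree G (?w l)) - 1)
      = (\<Prod>l\<in>{1..<Suc k}. real (gdegree G (w l)) - 1) * (real (gdegree G (w (Suc k))) - 1)"
    unfolding set by simp
  define A where "A \<longleftrightarrow> (\<forall>l<Suc k. (w l, w (l + 1)) \<in> adj G)"
  define B where "B \<longleftrightarrow> (\<forall>l\<in>{1..<Suc k}. w (l - 1) \<noteq> w (l + 1))"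
  define p where "p = (\<Prod>l\<in>{1..<Suc k}. real (gdegree G (w l)) - 1)"
  show ?thesis
    unfolding nb_weight_def 1 2 3 A_def[symmetric] B_def[symmetric] p_def[symmetric]
    by (simp add: nb_matrix_def)
qed

locale nb_graph =
  fixes G :: "'v mgraph"
  assumes graph: "multigraph G" and fin: "finite (verts G)"
    and adm: "admissible Non_Backtracking G"
begin

lemma mult_01: "mult G u v = (if (u, v) \<in> adj G then 1 else 0)"
  using adm unfolding adj_def by (auto simp: simple_graph_def intro: le_antisym)

lemma degree_sum: "real (gdegree G u) = (\<Sum>v\<in>verts G. if (u, v) \<in> adj G then 1 else 0)"
proof -
  have "mult G u u = 0" using adm by (simp add: simple_graph_def loop_free_def)
  then have "gdegree G u = (\<Sum>v\<in>verts G. mult G u v)"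
    using gdegree_eq_sum[OF graph fin, of u] by simp
  then show ?thesis by (simp only: mult_01 of_nat_sum of_nat_0 of_nat_1 if_distrib[of real])
qed

lemma adj_sym: "(u, v) \<in> adj G \<longleftrightarrow> (v, u) \<in> adj G"
  using sym_adj[OF graph] by (auto dest: symD)

lemma degree_sum': "real (gdegree G u) = (\<Sum>v\<in>verts G. if (v, u) \<in> adj G then 1 else 0)"
  unfolding degree_sum by (rule sum.cong) (auto simp: adj_sym)

lemma degree_ge_2: "u \<in> verts G \<Longrightarrow> gdegree G u \<ge> 2"
  using adm by simp

lemma sum_neighbours_but_one:
  assumes "(b, a) \<in> adj G"
  shows "(\<Sum>c\<in>verts G. if (b, c) \<in> adj G \<and> a \<noteq> c then 1 / (real (gdegree G b) - 1) else 0) = 1"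
proof -
  have V: "b \<in> verts G" "a \<in> verts G" using adj_verts[OF graph assms] by auto
  have "(\<Sum>c\<in>verts G. if (b, c) \<in> adj G \<and> a \<noteq> c then 1 else 0)
      = (\<Sum>c\<in>verts G. (if (b, c) \<in> adj G then 1 else 0) - (if c = a then 1 else 0 :: real))"
    by (rule sum.cong) (use assms in auto)
  also have "\<dots> = real (gdegree G b) - 1"
    using V fin by (simp add: sum_subtractf degree_sum)
  finally have "(\<Sum>c\<in>verts G. if (b, c) \<in> adj G \<and> a \<noteq> c then 1 else 0) = real (gdegree G b) - 1" .
  moreover have "(\<Sum>c\<in>verts G. if (b, c) \<in> adj G \<and> a \<noteq> c then 1 / (real (gdegree G b) - 1) else 0)
      = (\<Sum>c\<in>verts G. if (b, c) \<in> adj G \<and> a \<noteq> c then 1 else 0) / (real (gdegree G b) - 1)"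
    unfolding sum_divide_distrib by (rule sum.cong) auto
  ultimately show ?thesis using degree_ge_2[OF V(1)] by simp
qed

text \<open>Only the directed edges out of \<open>b\<close> can follow a directed edge into \<open>b\<close>.\<close>

lemma nb_row_apply:
  assumes "b \<in> verts G"
  shows "(\<Sum>f\<in>adj G. nb_matrix G (a, b) f * h f)
    = (\<Sum>c\<in>verts G. if (b, c) \<in> adj G then nb_matrix G (a, b) (b, c) * h (b, c) else 0)"
proof -
  have "(\<Sum>f\<in>adj G. nb_matrix G (a, b) f * h f)
      = (\<Sum>b'\<in>verts G. if b' = b then
          \<Sum>c\<in>verts G. if (b, c) \<in> adj G then nb_matrix G (a, b) (b, c) * h (b, c) else 0 else 0)"
    unfolding sum_adj[OF graph fin]
    by (rule sum.cong) (auto simp: nb_matrix_def intro!: sum.neutral)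
  then show ?thesis using assms fin by simp
qed

text \<open>The matrix is doubly stochastic: of the \<open>d\<^sub>b\<close> edges at a vertex \<open>b\<close>, all but one may be taken
  after a given edge into \<open>b\<close>, and all but one may precede a given edge out of \<open>b\<close>.\<close>

lemma nb_row_sum: "e \<in> adj G \<Longrightarrow> (\<Sum>f\<in>adj G. nb_matrix G e f) = 1"
proof (cases e)
  fix a b assume e: "e \<in> adj G" "e = (a, b)"
  then have V: "b \<in> verts G" using adj_verts[OF graph] by blast
  have "(\<Sum>f\<in>adj G. nb_matrix G e f)
      = (\<Sum>c\<in>verts G. if (b, c) \<in> adj G \<and> a \<noteq> c then 1 / (real (gdegree G b) - 1) else 0)"
    using nb_row_apply[OF V, of a "\<lambda>_. 1"] e
    by simp (auto simp: nb_matrix_def intro!: sum.cong)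
  then show ?thesis using sum_neighbours_but_one[of b a] e adj_sym[of a b] by simp
qed

lemma nb_column_sum: "f \<in> adj G \<Longrightarrow> (\<Sum>e\<in>adj G. nb_matrix G e f) = 1"
proof (cases f)
  fix b c assume f: "f \<in> adj G" "f = (b, c)"
  then have V: "b \<in> verts G" using adj_verts[OF graph] by blast
  have "(\<Sum>e\<in>adj G. nb_matrix G e f) = (\<Sum>b'\<in>verts G. \<Sum>a\<in>verts G.
      if (a, b') \<in> adj G then nb_matrix G (a, b') f else 0)"
    unfolding sum_adj[OF graph fin] by (rule sum.swap)
  also have "\<dots> = (\<Sum>b'\<in>verts G. if b' = b then
      \<Sum>a\<in>verts G. if (a, b) \<in> adj G then nb_matrix G (a, b) f else 0 else 0)"
    using f by (intro sum.cong) (auto simp: nb_matrix_def intro!: sum.neutral)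
  also have "\<dots> = (\<Sum>a\<in>verts G. if (b, a) \<in> adj G \<and> c \<noteq> a then 1 / (real (gdegree G b) - 1) else 0)"
    using V fin f by (auto simp: nb_matrix_def adj_sym[of b] intro!: sum.cong)
  also have "\<dots> = 1" using sum_neighbours_but_one[of b c] f by simp
  finally show ?thesis .
qed

sublocale finite_chain "adj G" "nb_matrix G"
proof
  show "nb_matrix G e f \<ge> 0" if ef: "e \<in> adj G" "f \<in> adj G" for e f
  proof -
    have "snd e \<in> verts G" using adj_verts[OF graph, of "fst e" "snd e"] ef by simp
    then show ?thesis using degree_ge_2[of "snd e"] by (auto simp: nb_matrix_def)
  qed
qed (use finite_adj[OF graph fin] nb_row_sum in auto)

text \<open>The last two vertices of a non-backtracking walk form a directed edge, which performs a
  Markov chain with transition matrix \<open>nb_matrix G\<close>, started from a directed edge out of \<open>i\<close>.\<close>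

lemma sum_nb_weight:
  assumes i: "i \<in> verts G"
  shows "(\<Sum>w\<in>{0..Suc k} \<rightarrow>\<^sub>E verts G. nb_weight G i (Suc k) w * h (w k, w (Suc k)))
    = (\<Sum>e\<in>adj G. if fst e = i then \<Sum>f\<in>adj G. mat_pow (adj G) (nb_matrix G) k e f * h f else 0)"
proof (induction k arbitrary: h)
  case 0
  have "(\<Sum>w\<in>{0..Suc 0} \<rightarrow>\<^sub>E verts G. nb_weight G i (Suc 0) w * h (w 0, w (Suc 0)))
      = (\<Sum>b\<in>verts G. \<Sum>c\<in>verts G. if (b, c) \<in> adj G then if b = i then h (b, c) else 0 else 0)"
    unfolding sum_PiE_Suc sum_PiE_0 by (intro sum.cong) (auto simp: nb_weight_def)
  also have "\<dots> = (\<Sum>e\<in>adj G. if fst e = i then h e else 0)"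
    unfolding sum_adj[OF graph fin] fst_conv by (rule refl)
  also have "\<dots> = (\<Sum>e\<in>adj G. if fst e = i then \<Sum>f\<in>adj G. mat_pow (adj G) (nb_matrix G) 0 e f * h f else 0)"
  proof (intro sum.cong if_cong refl)
    fix e assume "e \<in> adj G"
    moreover have "(\<Sum>f\<in>adj G. mat_pow (adj G) (nb_matrix G) 0 e f * h f)
        = (\<Sum>f\<in>adj G. if e = f then h f else 0)"
      by (rule sum.cong) auto
    ultimately show "h e = (\<Sum>f\<in>adj G. mat_pow (adj G) (nb_matrix G) 0 e f * h f)"
      using finite_S by simp
  qed
  finally show ?case .
next
  case (Suc k)
  let ?A = "adj G" and ?P = "nb_matrix G"
  define h' where "h' e = (\<Sum>f\<in>?A. ?P e f * h f)" for e
  have "(\<Sum>w\<in>{0..Suc (Suc k)} \<rightarrow>\<^sub>E verts G. nb_weight G i (Suc (Suc k)) w * h (w (Suc k), w (Suc (Suc k))))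
      = (\<Sum>w\<in>{0..Suc k} \<rightarrow>\<^sub>E verts G. nb_weight G i (Suc k) w * h' (w k, w (Suc k)))"
    unfolding sum_PiE_Suc[of _ "Suc k"]
  proof (rule sum.cong)
    fix w assume "w \<in> {0..Suc k} \<rightarrow>\<^sub>E verts G"
    then have w: "w (Suc k) \<in> verts G" by auto
    show "(\<Sum>c\<in>verts G. nb_weight G i (Suc (Suc k)) (w(Suc (Suc k) := c)) *
          h ((w(Suc (Suc k) := c)) (Suc k), (w(Suc (Suc k) := c)) (Suc (Suc k))))
        = nb_weight G i (Suc k) w * h' (w k, w (Suc k))"
      unfolding h'_def nb_row_apply[OF w] nb_weight_extend sum_distrib_left
      by (rule sum.cong) auto
  qed simp
  also have "\<dots> = (\<Sum>e\<in>?A. if fst e = i then \<Sum>f\<in>?A. mat_pow ?A ?P k e f * h' f else 0)"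
    by (rule Suc.IH)
  also have "\<dots> = (\<Sum>e\<in>?A. if fst e = i then \<Sum>f\<in>?A. mat_pow ?A ?P (Suc k) e f * h f else 0)"
  proof (rule sum.cong[OF refl], rule if_cong[OF refl _ refl])
    fix e assume e: "e \<in> ?A"
    have one: "mat_pow ?A ?P 1 g f = ?P g f" if "f \<in> ?A" for f g
    proof -
      have "mat_pow ?A ?P 1 g f = (\<Sum>z\<in>?A. if z = f then ?P g z else 0)"
        by (simp only: One_nat_def mat_pow.simps) (rule sum.cong, auto)
      then show ?thesis using that finite_S by simp
    qed
    have "(\<Sum>f\<in>?A. mat_pow ?A ?P k e f * h' f)
        = (\<Sum>f\<in>?A. (\<Sum>g\<in>?A. mat_pow ?A ?P k e g * ?P g f) * h f)"
      unfolding h'_def sum_distrib_left sum_distrib_right mult.assoc by (rule sum.swap)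
    also have "\<dots> = (\<Sum>f\<in>?A. mat_pow ?A ?P (k + 1) e f * h f)"
      by (rule sum.cong[OF refl]) (simp only: mat_pow_add[OF e] one cong: sum.cong)
    finally show "(\<Sum>f\<in>?A. mat_pow ?A ?P k e f * h' f)
        = (\<Sum>f\<in>?A. mat_pow ?A ?P (Suc k) e f * h f)" by simp
  qed
  finally show ?case .
qed

lemma exploration_prob_eq:
  assumes "i \<in> verts G"
  shows "exploration_prob Non_Backtracking (Suc k) G i j
    = (\<Sum>e\<in>adj G. if fst e = i then
         \<Sum>f\<in>adj G. mat_pow (adj G) (nb_matrix G) k e f * (if snd f = j then 1 else 0) else 0)
      / real (gdegree G i)"
proof -
  have "exploration_prob Non_Backtracking (Suc k) G i j
      = (\<Sum>w\<in>{0..Suc k} \<rightarrow>\<^sub>E verts G. nb_weight G i (Suc k) w * (if w (Suc k) = j then 1 else 0)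
          / real (gdegree G i))"
    unfolding exploration_prob.simps
  proof (rule sum.mono_neutral_cong_left)
    show "finite ({0..Suc k} \<rightarrow>\<^sub>E verts G)" using fin by (intro finite_PiE) auto
  qed (auto simp: nb_walks_def nb_weight_def)
  also have "\<dots> = (\<Sum>w\<in>{0..Suc k} \<rightarrow>\<^sub>E verts G. nb_weight G i (Suc k) w
      * (if snd (w k, w (Suc k)) = j then 1 else 0)) / real (gdegree G i)"
    by (simp add: sum_divide_distrib)
  finally show ?thesis
    unfolding sum_nb_weight[OF assms, of k "\<lambda>f. if snd f = j then 1 else 0"] .
qed

lemma card_adj: "real (card (adj G)) = (\<Sum>l\<in>verts G. real (gdegree G l))"
  using sum_adj[OF graph fin, of "\<lambda>_. 1"] by (simp add: degree_sum)

lemma sum_edges_from: "i \<in> verts G \<Longrightarrow> (\<Sum>e\<in>adj G. if fst e = i then c else 0) = real (gdegree G i) * c"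
proof -
  assume i: "i \<in> verts G"
  have "(\<Sum>e\<in>adj G. if fst e = i then c else 0)
      = (\<Sum>a\<in>verts G. if a = i then \<Sum>b\<in>verts G. if (a, b) \<in> adj G then c else 0 else 0)"
    unfolding sum_adj[OF graph fin] fst_conv by (rule sum.cong) (auto intro!: sum.neutral)
  also have "\<dots> = (\<Sum>b\<in>verts G. (if (i, b) \<in> adj G then 1 else 0) * c)"
    using i fin by simp (rule sum.cong, auto)
  finally show ?thesis by (simp only: degree_sum sum_distrib_right)
qed

lemma sum_edges_to: "j \<in> verts G \<Longrightarrow> (\<Sum>e\<in>adj G. if snd e = j then 1 else 0) = real (gdegree G j)"
proof -
  assume j: "j \<in> verts G"
  have "(\<Sum>e\<in>adj G. if snd e = j then 1 else 0)
      = (\<Sum>b\<in>verts G. if b = j then \<Sum>a\<in>verts G. if (a, b) \<in> adj G then 1 else 0 else 0 :: real)"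
    unfolding sum_adj[OF graph fin] snd_conv
    by (subst sum.swap, rule sum.cong) (auto intro!: sum.neutral)
  then show ?thesis using j fin by (simp add: degree_sum')
qed

text \<open>Being doubly stochastic, the chain on directed edges equidistributes, and a uniform directed
  edge points to \<open>j\<close> with probability proportional to the degree of \<open>j\<close>.\<close>

lemma nonbacktracking_prob_tendsto:
  assumes erg: "ergodic_exploration Non_Backtracking G"
    and i: "i \<in> verts G" and j: "j \<in> verts G"
  shows "(\<lambda>k. exploration_prob Non_Backtracking k G i j) \<longlonglongrightarrow> stationary_prob G j"
proof -
  let ?A = "adj G" and ?P = "nb_matrix G"
  have di: "real (gdegree G i) > 0" using degree_ge_2[OF i] by simp
  have "real (gdegree G i) \<le> (\<Sum>l\<in>verts G. real (gdegree G l))"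
    by (rule member_le_sum) (use i fin in auto)
  then have D: "real (card ?A) > 0" using di card_adj by simp
  have lim: "(\<lambda>k. mat_pow ?A ?P k e f) \<longlonglongrightarrow> 1 / real (card ?A)" if "e \<in> ?A" "f \<in> ?A" for e f
    by (rule mat_pow_tendsto_stationary[OF _ _ _ _ _ that])
      (use erg D nb_column_sum in \<open>auto simp: sum_divide_distrib[symmetric]\<close>)
  have "(\<lambda>k. exploration_prob Non_Backtracking (Suc k) G i j) \<longlonglongrightarrow>
      (\<Sum>e\<in>?A. if fst e = i then
         \<Sum>f\<in>?A. 1 / real (card ?A) * (if snd f = j then 1 else 0) else 0) / real (gdegree G i)"
    unfolding exploration_prob_eq[OF i]
  proof (intro tendsto_divide tendsto_sum tendsto_const)
    fix e assume e: "e \<in> ?A"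
    show "(\<lambda>k. if fst e = i then \<Sum>f\<in>?A. mat_pow ?A ?P k e f * (if snd f = j then 1 else 0) else 0)
        \<longlonglongrightarrow> (if fst e = i then \<Sum>f\<in>?A. 1 / real (card ?A) * (if snd f = j then 1 else 0) else 0)"
      by (cases "fst e = i") (auto intro!: tendsto_sum tendsto_mult tendsto_const lim e)
  qed (use di in auto)
  also have "(\<Sum>e\<in>?A. if fst e = i then
         \<Sum>f\<in>?A. 1 / real (card ?A) * (if snd f = j then 1 else 0) else 0) / real (gdegree G i)
      = stationary_prob G j"
    unfolding sum_edges_from[OF i] sum_distrib_left[symmetric] sum_edges_to[OF j]
    using di by (simp add: stationary_prob_def card_adj)
  finally show ?thesis by (rule LIMSEQ_imp_Suc)
qed

end

lemma integral_empirical_measure: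
  assumes "finite V" and f: "f \<in> borel_measurable borel"
  shows "(\<integral>t. f t \<partial>empirical_measure V x) = (\<Sum>i\<in>V. f (x i)) / real (card V)"
proof -
  have "(\<integral>t. f t \<partial>empirical_measure V x) = (\<integral>i. f (x i) \<partial>uniform_count_measure V)"
    unfolding empirical_measure_def using f
    by (intro integral_distr) (simp_all add: measurable_def space_uniform_count_measure
        sets_uniform_count_measure)
  then show ?thesis using assms(1) by (simp add: integral_uniform_count_measure)
qed

lemma real_distribution_empirical_measure:
  assumes "finite V" "V \<noteq> {}"
  shows "real_distribution (empirical_measure V x)"
proof -
  interpret prob_space "uniform_count_measure V"
    by (rule prob_space_uniform_count_measure[OF assms])
  show ?thesis
    unfolding empirical_measure_def
    by (rule real_distribution_distr) (simp add: measurable_def space_uniform_count_measure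
        sets_uniform_count_measure)
qed

lemma weak_conv_empirical_measure:
  assumes V: "finite V" "V \<noteq> {}" and lim: "\<And>i. i \<in> V \<Longrightarrow> (\<lambda>k. x k i) \<longlonglongrightarrow> y i"
  shows "weak_conv_m (\<lambda>k. empirical_measure V (x k)) (empirical_measure V y)"
proof (rule integral_bdd_continuous_conv_imp_weak_conv)
  fix f :: "real \<Rightarrow> real"
  assume f: "\<And>x. isCont f x"
  then have m: "f \<in> borel_measurable borel"
    by (intro borel_measurable_continuous_onI) (simp add: continuous_at_imp_continuous_on)
  show "(\<lambda>k. \<integral>t. f t \<partial>empirical_measure V (x k)) \<longlonglongrightarrow> (\<integral>t. f t \<partial>empirical_measure V y)"
    unfolding integral_empirical_measure[OF V(1) m]
    by (intro tendsto_divide tendsto_sum tendsto_const isCont_tendsto_compose[OF f] lim)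
      (use V in auto)
qed (use V real_distribution_empirical_measure in auto)

theorem bias_measure_weak_conv:
  assumes G: "multigraph G" "finite (verts G)" "verts G \<noteq> {}"
    and adm: "admissible e G" and erg: "ergodic_exploration e G"
  shows "weak_conv_m (\<lambda>k. bias_measure e k G) (stationary_bias_measure G)"
proof -
  have lim: "(\<lambda>k. exploration_prob e k G i j) \<longlonglongrightarrow> stationary_prob G j"
    if "i \<in> verts G" "j \<in> verts G" for i j
  proof (cases e)
    case Non_Backtracking
    then interpret nb_graph G using G adm by unfold_locales auto
    show ?thesis using nonbacktracking_prob_tendsto that erg Non_Backtracking by simp
  next
    case Backtracking
    then show ?thesis using backtracking_prob_tendsto[OF G(1,2)] that adm erg by simp
  qed
  show ?thesis
    unfolding bias_measure_def stationary_bias_measure_def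
  proof (rule weak_conv_empirical_measure)
    fix i assume i: "i \<in> verts G"
    show "(\<lambda>k. friendship_bias e k G i) \<longlonglongrightarrow> stationary_bias G i"
      unfolding friendship_bias_def stationary_bias_def
      by (intro tendsto_diff tendsto_sum tendsto_mult tendsto_const lim i)
  qed (use G in auto)
qed

section \<open>Averages over uniformly integrable arrays\<close>

text \<open>For all large \<open>n\<close>, the event \<open>A n\<close> fails with probability at most \<open>\<eta>\<close>. Failure is measured
  by an enclosing measurable event, so that \<open>A\<close> need not be measurable and the property is preserved
  by weakening \<open>A\<close>.\<close>

definition fails_rarely ::
  "(nat \<Rightarrow> 'w measure) \<Rightarrow> real \<Rightarrow> (nat \<Rightarrow> 'w \<Rightarrow> bool) \<Rightarrow> bool" where
  "fails_rarely M \<eta> A \<longleftrightarrow> (\<exists>B. (\<forall>n. B n \<in> sets (M n)) \<and>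
     (\<forall>\<^sub>F n in sequentially. measure (M n) (B n) \<le> \<eta> \<and> (\<forall>\<omega>\<in>space (M n) - B n. A n \<omega>)))"

lemma fails_rarelyI:
  assumes "\<And>n. B n \<in> sets (M n)"
    and "\<forall>\<^sub>F n in sequentially. measure (M n) (B n) \<le> \<eta> \<and> (\<forall>\<omega>\<in>space (M n) - B n. A n \<omega>)"
  shows "fails_rarely M \<eta> A"
  unfolding fails_rarely_def using assms by (intro exI[of _ B]) blast

lemma fails_rarely_mono:
  assumes "fails_rarely M \<eta> A"
    and "\<forall>\<^sub>F n in sequentially. \<forall>\<omega>\<in>space (M n). A n \<omega> \<longrightarrow> A' n \<omega>"
  shows "fails_rarely M \<eta> A'"
proof -
  obtain B where B: "\<forall>n. B n \<in> sets (M n)"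
    "\<forall>\<^sub>F n in sequentially. measure (M n) (B n) \<le> \<eta> \<and> (\<forall>\<omega>\<in>space (M n) - B n. A n \<omega>)"
    using assms(1) by (auto simp: fails_rarely_def)
  have "\<forall>\<^sub>F n in sequentially. measure (M n) (B n) \<le> \<eta> \<and> (\<forall>\<omega>\<in>space (M n) - B n. A' n \<omega>)"
    using B(2) assms(2) by eventually_elim blast
  with B(1) show ?thesis by (intro fails_rarelyI[of B]) auto
qed

lemma fails_rarely_conj:
  assumes "fails_rarely M \<eta> A" "fails_rarely M \<eta>' A'"
  shows "fails_rarely M (\<eta> + \<eta>') (\<lambda>n \<omega>. A n \<omega> \<and> A' n \<omega>)"
proof -
  obtain B B' where B: "\<forall>n. B n \<in> sets (M n)"
    "\<forall>\<^sub>F n in sequentially. measure (M n) (B n) \<le> \<eta> \<and> (\<forall>\<omega>\<in>space (M n) - B n. A n \<omega>)"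
    and B': "\<forall>n. B' n \<in> sets (M n)"
    "\<forall>\<^sub>F n in sequentially. measure (M n) (B' n) \<le> \<eta>' \<and> (\<forall>\<omega>\<in>space (M n) - B' n. A' n \<omega>)"
    using assms by (auto simp: fails_rarely_def)
  have "\<forall>\<^sub>F n in sequentially. measure (M n) (B n \<union> B' n) \<le> \<eta> + \<eta>'
      \<and> (\<forall>\<omega>\<in>space (M n) - (B n \<union> B' n). A n \<omega> \<and> A' n \<omega>)"
    using B(2) B'(2)
  proof eventually_elim
    case (elim n)
    have "measure (M n) (B n \<union> B' n) \<le> measure (M n) (B n) + measure (M n) (B' n)"
      using B(1) B'(1) by (intro measure_Un_le) auto
    then have "measure (M n) (B n \<union> B' n) \<le> \<eta> + \<eta>'" using elim by linarith
    moreover have "A n \<omega> \<and> A' n \<omega>" if "\<omega> \<in> space (M n) - (B n \<union> B' n)" for \<omega>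
      using that elim by simp
    ultimately show ?case by simp
  qed
  moreover have "B n \<union> B' n \<in> sets (M n)" for n using B(1) B'(1) by simp
  ultimately show ?thesis by (intro fails_rarelyI[of "\<lambda>n. B n \<union> B' n"])
qed

lemma fails_rarely_witness:
  assumes "fails_rarely M \<eta> A" "\<eta> < 1" "\<forall>\<^sub>F n in sequentially. prob_space (M n)"
    and "\<forall>\<^sub>F n in sequentially. Q n"
  obtains n \<omega> where "Q n" "\<omega> \<in> space (M n)" "A n \<omega>"
proof -
  obtain B where B: "\<forall>n. B n \<in> sets (M n)"
    "\<forall>\<^sub>F n in sequentially. measure (M n) (B n) \<le> \<eta> \<and> (\<forall>\<omega>\<in>space (M n) - B n. A n \<omega>)"
    using assms(1) by (auto simp: fails_rarely_def)
  have "\<forall>\<^sub>F n in sequentially. Q n \<and> (\<exists>\<omega>\<in>space (M n). A n \<omega>)"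
    using B(2) assms(3,4)
  proof eventually_elim
    case (elim n)
    interpret prob_space "M n" by fact
    have "B n \<noteq> space (M n)" using elim assms(2) prob_space by auto
    moreover have "B n \<subseteq> space (M n)" using B(1) sets.sets_into_space by blast
    ultimately obtain \<omega> where "\<omega> \<in> space (M n) - B n" by blast
    then show ?case using elim by blast
  qed
  then obtain n where "Q n \<and> (\<exists>\<omega>\<in>space (M n). A n \<omega>)"
    unfolding eventually_sequentially by blast
  then show thesis using that by blast
qed

lemma conv_in_prob_fails_rarely:
  assumes "conv_in_prob M X c" "\<epsilon> > 0" "\<eta> > 0"
  shows "fails_rarely M \<eta> (\<lambda>n \<omega>. \<bar>X n \<omega> - c\<bar> \<le> \<epsilon>)"
proof -
  define B where
    "B n = (if X n \<in> borel_measurable (M n) then {\<omega> \<in> space (M n). \<bar>X n \<omega> - c\<bar> > \<epsilon>} else {})" for n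
  have m: "\<forall>\<^sub>F n in sequentially. X n \<in> borel_measurable (M n)"
    and lim: "(\<lambda>n. measure (M n) {\<omega> \<in> space (M n). \<bar>X n \<omega> - c\<bar> > \<epsilon>}) \<longlonglongrightarrow> 0"
    using assms by (auto simp: conv_in_prob_def)
  have "\<forall>\<^sub>F n in sequentially. measure (M n) {\<omega> \<in> space (M n). \<bar>X n \<omega> - c\<bar> > \<epsilon>} < \<eta>"
    by (rule order_tendstoD(2)[OF lim assms(3)])
  then have "\<forall>\<^sub>F n in sequentially. measure (M n) (B n) \<le> \<eta> \<and>
      (\<forall>\<omega>\<in>space (M n) - B n. \<bar>X n \<omega> - c\<bar> \<le> \<epsilon>)"
    using m by eventually_elim (auto simp: B_def)
  moreover have "B n \<in> sets (M n)" for n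
    unfolding B_def by (auto intro: measurable_sets)
  ultimately show ?thesis by (intro fails_rarelyI[of B])
qed

lemma conv_in_probI:
  assumes prob: "\<forall>\<^sub>F n in sequentially. prob_space (M n)"
    and meas: "\<forall>\<^sub>F n in sequentially. X n \<in> borel_measurable (M n)"
    and rare: "\<And>\<epsilon> \<eta>. \<epsilon> > 0 \<Longrightarrow> \<eta> > 0 \<Longrightarrow> fails_rarely M \<eta> (\<lambda>n \<omega>. \<bar>X n \<omega> - c\<bar> \<le> \<epsilon>)"
  shows "conv_in_prob M X c"
  unfolding conv_in_prob_def
proof (intro conjI meas allI impI)
  fix \<epsilon> :: real assume \<epsilon>: "\<epsilon> > 0"
  show "(\<lambda>n. measure (M n) {\<omega> \<in> space (M n). \<bar>X n \<omega> - c\<bar> > \<epsilon>}) \<longlonglongrightarrow> 0"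
  proof (rule order_tendstoI)
    fix a :: real assume "a < 0"
    then show "\<forall>\<^sub>F n in sequentially. a < measure (M n) {\<omega> \<in> space (M n). \<bar>X n \<omega> - c\<bar> > \<epsilon>}"
      by (intro always_eventually allI) (meson measure_nonneg order_less_le_trans)
  next
    fix a :: real assume a: "a > 0"
    obtain B where B: "\<forall>n. B n \<in> sets (M n)" "\<forall>\<^sub>F n in sequentially.
        measure (M n) (B n) \<le> a / 2 \<and> (\<forall>\<omega>\<in>space (M n) - B n. \<bar>X n \<omega> - c\<bar> \<le> \<epsilon>)"
      using rare[of \<epsilon> "a / 2"] \<epsilon> a by (auto simp: fails_rarely_def)
    show "\<forall>\<^sub>F n in sequentially. measure (M n) {\<omega> \<in> space (M n). \<bar>X n \<omega> - c\<bar> > \<epsilon>} < a"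
      using B(2) prob
    proof eventually_elim
      case (elim n)
      interpret prob_space "M n" by fact
      have "measure (M n) {\<omega> \<in> space (M n). \<bar>X n \<omega> - c\<bar> > \<epsilon>} \<le> measure (M n) (B n)"
      proof (rule finite_measure_mono)
        show "{\<omega> \<in> space (M n). \<bar>X n \<omega> - c\<bar> > \<epsilon>} \<subseteq> B n"
          using elim by (auto simp: not_le[symmetric])
      qed (use B(1) in simp)
      then show ?case using elim a by simp
    qed
  qed
qed

lemma conv_in_prob_cong:
  assumes "conv_in_prob M X c"
    and eq: "\<forall>\<^sub>F n in sequentially. \<forall>\<omega>\<in>space (M n). X n \<omega> = Y n \<omega>"
  shows "conv_in_prob M Y c"
  unfolding conv_in_prob_def
proof (intro conjI allI impI)
  show "\<forall>\<^sub>F n in sequentially. Y n \<in> borel_measurable (M n)"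
    using conjunct1[OF assms(1)[unfolded conv_in_prob_def]] eq
    by eventually_elim (simp cong: measurable_cong)
  fix \<epsilon> :: real assume "\<epsilon> > 0"
  then have "(\<lambda>n. measure (M n) {\<omega> \<in> space (M n). \<bar>X n \<omega> - c\<bar> > \<epsilon>}) \<longlonglongrightarrow> 0"
    using assms(1) by (auto simp: conv_in_prob_def)
  moreover have "\<forall>\<^sub>F n in sequentially. measure (M n) {\<omega> \<in> space (M n). \<bar>X n \<omega> - c\<bar> > \<epsilon>}
      = measure (M n) {\<omega> \<in> space (M n). \<bar>Y n \<omega> - c\<bar> > \<epsilon>}"
    using eq by eventually_elim (auto intro!: arg_cong[where f = "measure _"])
  ultimately show "(\<lambda>n. measure (M n) {\<omega> \<in> space (M n). \<bar>Y n \<omega> - c\<bar> > \<epsilon>}) \<longlonglongrightarrow> 0"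
    by (rule Lim_transform_eventually)
qed

lemma conv_in_prob_divide:
  assumes X: "conv_in_prob M X x" and Y: "conv_in_prob M Y y" and y: "y \<noteq> 0"
    and prob: "\<forall>\<^sub>F n in sequentially. prob_space (M n)"
  shows "conv_in_prob M (\<lambda>n \<omega>. X n \<omega> / Y n \<omega>) (x / y)"
proof (rule conv_in_probI[OF prob])
  have "\<forall>\<^sub>F n in sequentially. X n \<in> borel_measurable (M n)"
    "\<forall>\<^sub>F n in sequentially. Y n \<in> borel_measurable (M n)"
    using X Y by (auto simp: conv_in_prob_def)
  then show "\<forall>\<^sub>F n in sequentially. (\<lambda>\<omega>. X n \<omega> / Y n \<omega>) \<in> borel_measurable (M n)"
    by eventually_elim (rule borel_measurable_divide)
next
  fix \<epsilon> \<eta> :: real assume \<epsilon>: "\<epsilon> > 0" and \<eta>: "\<eta> > 0"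
  have "isCont (\<lambda>p. fst p / snd p) (x, y)" using y by (intro continuous_intros) auto
  then obtain \<delta> where \<delta>: "\<delta> > 0"
    "\<And>p. dist p (x, y) < \<delta> \<Longrightarrow> dist (fst p / snd p) (x / y) < \<epsilon>"
    using \<epsilon> by (auto simp: continuous_at_eps_delta)
  have "fails_rarely M (\<eta> / 2 + \<eta> / 2) (\<lambda>n \<omega>. \<bar>X n \<omega> - x\<bar> \<le> \<delta> / 4 \<and> \<bar>Y n \<omega> - y\<bar> \<le> \<delta> / 4)"
    by (intro fails_rarely_conj conv_in_prob_fails_rarely X Y) (use \<eta> \<delta> in auto)
  then have "fails_rarely M \<eta> (\<lambda>n \<omega>. \<bar>X n \<omega> - x\<bar> \<le> \<delta> / 4 \<and> \<bar>Y n \<omega> - y\<bar> \<le> \<delta> / 4)"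
    by simp
  then show "fails_rarely M \<eta> (\<lambda>n \<omega>. \<bar>X n \<omega> / Y n \<omega> - x / y\<bar> \<le> \<epsilon>)"
  proof (rule fails_rarely_mono, intro always_eventually allI ballI impI)
    fix n \<omega> assume *: "\<bar>X n \<omega> - x\<bar> \<le> \<delta> / 4 \<and> \<bar>Y n \<omega> - y\<bar> \<le> \<delta> / 4"
    have "dist (X n \<omega>, Y n \<omega>) (x, y) \<le> \<bar>X n \<omega> - x\<bar> + \<bar>Y n \<omega> - y\<bar>"
      unfolding dist_Pair_Pair dist_real_def by (rule order_trans[OF sqrt_sum_squares_le_sum_abs]) simp
    then have "dist (X n \<omega>, Y n \<omega>) (x, y) < \<delta>" using * \<delta>(1) by simp
    from \<delta>(2)[OF this] show "\<bar>X n \<omega> / Y n \<omega> - x / y\<bar> \<le> \<epsilon>" by (simp add: dist_real_def)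
  qed
qed

text \<open>The values \<open>D n \<omega> i\<close>, for \<open>i\<close> in \<open>{1..n}\<close>, are the degrees of the \<open>n\<close>-th random graph,
  and \<open>N\<close> is the degree distribution of the root of the local limit.\<close>

locale degree_array =
  fixes M :: "nat \<Rightarrow> 'w measure" and D :: "nat \<Rightarrow> 'w \<Rightarrow> nat \<Rightarrow> nat"
    and N :: "nat measure" and n0 :: nat
  assumes n0: "n0 > 0"
    and prob: "\<And>n. n \<ge> n0 \<Longrightarrow> prob_space (M n)"
    and meas: "\<And>n i. n \<ge> n0 \<Longrightarrow> i \<in> {1..n} \<Longrightarrow> (\<lambda>\<omega>. D n \<omega> i) \<in> measurable (M n) (count_space UNIV)"
    and pos: "\<And>n \<omega> i. n \<ge> n0 \<Longrightarrow> \<omega> \<in> space (M n) \<Longrightarrow> i \<in> {1..n} \<Longrightarrow> D n \<omega> i > 0"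
    and ui: "uniformly_integrable {(n, i). n \<ge> n0 \<and> i \<in> {1..n}} (\<lambda>(n, i). M n)
              (\<lambda>(n, i) \<omega>. (real (D n \<omega> i))\<^sup>2)"
    and prob_N: "prob_space N" and sets_N: "sets N = UNIV"
    and conv: "\<And>g :: nat \<Rightarrow> real. bounded (range g) \<Longrightarrow>
       conv_in_prob M (\<lambda>n \<omega>. (\<Sum>i\<in>{1..n}. g (D n \<omega> i)) / real n) (\<integral>d. g d \<partial>N)"
begin

sublocale N: prob_space N by (rule prob_N)

lemma measurable_N [measurable]: "g \<in> borel_measurable N"
  using sets_N by (simp add: measurable_def)

lemma ev_prob: "\<forall>\<^sub>F n in sequentially. prob_space (M n)"
  using prob unfolding eventually_sequentially by blast

definition avg :: "nat \<Rightarrow> 'w \<Rightarrow> (nat \<Rightarrow> real) \<Rightarrow> real" where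
  "avg n \<omega> g = (\<Sum>i\<in>{1..n}. g (D n \<omega> i)) / real n"

lemma conv_avg: "bounded (range g) \<Longrightarrow> conv_in_prob M (\<lambda>n \<omega>. avg n \<omega> g) (\<integral>d. g d \<partial>N)"
  unfolding avg_def by (rule conv)

lemma avg_measurable: "n \<ge> n0 \<Longrightarrow> (\<lambda>\<omega>. avg n \<omega> g) \<in> borel_measurable (M n)"
  unfolding avg_def
  by (intro borel_measurable_divide borel_measurable_sum borel_measurable_const
      measurable_compose[OF meas]) auto

lemma avg_mono: "(\<And>i. i \<in> {1..n} \<Longrightarrow> g (D n \<omega> i) \<le> h (D n \<omega> i)) \<Longrightarrow> avg n \<omega> g \<le> avg n \<omega> h"
  unfolding avg_def by (intro divide_right_mono sum_mono) auto

lemma avg_diff: "avg n \<omega> (\<lambda>d. g d - h d) = avg n \<omega> g - avg n \<omega> h"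
  by (simp add: avg_def sum_subtractf diff_divide_distrib)

lemma avg_add: "avg n \<omega> (\<lambda>d. g d + h d) = avg n \<omega> g + avg n \<omega> h"
  by (simp add: avg_def sum.distrib add_divide_distrib)

lemma avg_cmult: "avg n \<omega> (\<lambda>d. c * g d) = c * avg n \<omega> g"
  by (simp add: avg_def sum_distrib_left[symmetric])

lemma avg_const: "n > 0 \<Longrightarrow> avg n \<omega> (\<lambda>_. c) = c"
  by (simp add: avg_def)

lemma avg_abs: "\<bar>avg n \<omega> g\<bar> \<le> avg n \<omega> (\<lambda>d. \<bar>g d\<bar>)"
  by (simp add: avg_def abs_divide divide_right_mono)

definition sq_tail :: "real \<Rightarrow> nat \<Rightarrow> real" where
  "sq_tail K d = (if (real d)\<^sup>2 > K then (real d)\<^sup>2 else 0)"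

text \<open>Markov's inequality turns uniform integrability into a bound in probability.\<close>

lemma avg_sq_tail_rare:
  assumes "\<epsilon> > 0" "\<eta> > 0"
  shows "\<forall>\<^sub>F K in at_top. fails_rarely M \<eta> (\<lambda>n \<omega>. avg n \<omega> (sq_tail K) \<le> \<epsilon>)"
proof -
  let ?I = "{(n, i). n \<ge> n0 \<and> i \<in> {1..n}}"
  let ?E = "\<lambda>K p. \<integral>\<^sup>+\<omega>. ennreal ((case p of (n, i) \<Rightarrow> \<lambda>\<omega>. (real (D n \<omega> i))\<^sup>2) \<omega> *
    indicator {\<omega>. (case p of (n, i) \<Rightarrow> \<lambda>\<omega>. (real (D n \<omega> i))\<^sup>2) \<omega> > K} \<omega>) \<partial>(case p of (n, i) \<Rightarrow> M n)"
  have "\<forall>\<^sub>F K in at_top. (SUP p\<in>?I. ?E K p) < ennreal (\<epsilon> * \<eta>)"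
    using order_tendstoD(2)[OF ui[unfolded uniformly_integrable_def], of "ennreal (\<epsilon> * \<eta>)"] assms
    by (simp add: ennreal_zero_less_mult_iff)
  then show ?thesis
  proof eventually_elim
    case (elim K)
    have tail: "(\<integral>\<^sup>+\<omega>. ennreal (sq_tail K (D n \<omega> i)) \<partial>M n) \<le> ennreal (\<epsilon> * \<eta>)"
      if ni: "n \<ge> n0" "i \<in> {1..n}" for n i
    proof -
      have "(\<integral>\<^sup>+\<omega>. ennreal (sq_tail K (D n \<omega> i)) \<partial>M n) = ?E K (n, i)"
        by (auto simp: sq_tail_def intro!: nn_integral_cong)
      also have "\<dots> \<le> (SUP p\<in>?I. ?E K p)" by (rule SUP_upper) (use ni in auto)
      finally show ?thesis using elim by simp
    qed
    have sq_tail_nonneg: "sq_tail K d \<ge> 0" for d by (simp add: sq_tail_def)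
    (* for n < n0 nothing is known about the average, not even measurability *)
    define B where "B n = (if n \<ge> n0 then {\<omega> \<in> space (M n). avg n \<omega> (sq_tail K) > \<epsilon>} else {})" for n
    have B: "B n \<in> sets (M n)" for n
      unfolding B_def using avg_measurable[of n "sq_tail K"] by (auto intro: measurable_sets)
    have "measure (M n) (B n) \<le> \<eta>" if n: "n \<ge> n0" for n
    proof -
      interpret prob_space "M n" by (rule prob[OF n])
      have n_pos: "n > 0" using n n0 by simp
      have m: "(\<lambda>\<omega>. ennreal (sq_tail K (D n \<omega> i))) \<in> borel_measurable (M n)" if "i \<in> {1..n}" for i
        by (rule measurable_compose[OF meas[OF n that]]) simp
      have "(\<integral>\<^sup>+\<omega>. ennreal (avg n \<omega> (sq_tail K)) \<partial>M n)
          = (\<integral>\<^sup>+\<omega>. ennreal (1 / real n) * (\<Sum>i\<in>{1..n}. ennreal (sq_tail K (D n \<omega> i))) \<partial>M n)"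
        by (rule nn_integral_cong)
          (simp add: avg_def sum_ennreal sq_tail_nonneg sum_nonneg ennreal_mult'[symmetric])
      also have "\<dots> = ennreal (1 / real n) * (\<integral>\<^sup>+\<omega>. (\<Sum>i\<in>{1..n}. ennreal (sq_tail K (D n \<omega> i))) \<partial>M n)"
        by (rule nn_integral_cmult) (rule borel_measurable_sum[OF m])
      also have "(\<integral>\<^sup>+\<omega>. (\<Sum>i\<in>{1..n}. ennreal (sq_tail K (D n \<omega> i))) \<partial>M n)
          = (\<Sum>i\<in>{1..n}. \<integral>\<^sup>+\<omega>. ennreal (sq_tail K (D n \<omega> i)) \<partial>M n)"
        by (rule nn_integral_sum) (rule m)
      also have "ennreal (1 / real n) * \<dots> \<le> ennreal (1 / real n) * (\<Sum>i\<in>{1..n}. ennreal (\<epsilon> * \<eta>))"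
        by (intro mult_left_mono sum_mono tail[OF n]) auto
      also have "(\<Sum>i\<in>{1..n}. ennreal (\<epsilon> * \<eta>)) = ennreal (\<Sum>i\<in>{1..n}. \<epsilon> * \<eta>)"
        using assms by (intro sum_ennreal) auto
      also have "ennreal (1 / real n) * \<dots> = ennreal (\<epsilon> * \<eta>)"
        using n_pos by (simp add: ennreal_mult'[symmetric])
      finally have E: "(\<integral>\<^sup>+\<omega>. ennreal (avg n \<omega> (sq_tail K)) \<partial>M n) \<le> ennreal (\<epsilon> * \<eta>)" .
      have "emeasure (M n) (B n) \<le> emeasure (M n) {\<omega> \<in> space (M n). 1 \<le> ennreal (1 / \<epsilon>) * ennreal (avg n \<omega> (sq_tail K))}"
      proof (rule emeasure_mono)
        show "B n \<subseteq> {\<omega> \<in> space (M n). 1 \<le> ennreal (1 / \<epsilon>) * ennreal (avg n \<omega> (sq_tail K))}"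
          using assms n by (auto simp: B_def ennreal_mult'[symmetric] ennreal_1[symmetric] divide_simps
              simp del: ennreal_1 intro!: ennreal_leI)
      qed (use avg_measurable[OF n, of "sq_tail K"] in measurable)
      also have "\<dots> \<le> ennreal (1 / \<epsilon>) * (\<integral>\<^sup>+\<omega>. ennreal (avg n \<omega> (sq_tail K)) * indicator (space (M n)) \<omega> \<partial>M n)"
        by (rule nn_integral_Markov_inequality) (use avg_measurable[OF n, of "sq_tail K"] in measurable)
      also have "(\<integral>\<^sup>+\<omega>. ennreal (avg n \<omega> (sq_tail K)) * indicator (space (M n)) \<omega> \<partial>M n)
          = (\<integral>\<^sup>+\<omega>. ennreal (avg n \<omega> (sq_tail K)) \<partial>M n)"
        by (rule nn_integral_cong) simp
      also have "ennreal (1 / \<epsilon>) * \<dots> \<le> ennreal (1 / \<epsilon>) * ennreal (\<epsilon> * \<eta>)"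
        by (intro mult_left_mono E) simp
      also have "\<dots> = ennreal \<eta>" using assms by (simp add: ennreal_mult'[symmetric])
      finally show ?thesis using assms by (simp add: emeasure_eq_measure)
    qed
    then have "\<forall>\<^sub>F n in sequentially. measure (M n) (B n) \<le> \<eta>
        \<and> (\<forall>\<omega>\<in>space (M n) - B n. avg n \<omega> (sq_tail K) \<le> \<epsilon>)"
      by (intro eventually_sequentiallyI[of n0]) (auto simp: B_def)
    then show ?case by (intro fails_rarelyI[of B] B)
  qed
qed

text \<open>Uniform integrability passes to the limit: all truncated second moments of \<open>N\<close> obey the bound
  that holds for the empirical averages with probability at least one half.\<close>

lemma integrable_square: "integrable N (\<lambda>d. (real d)\<^sup>2)"
proof -
  have "\<forall>\<^sub>F K in at_top. fails_rarely M (1/4) (\<lambda>n \<omega>. avg n \<omega> (sq_tail K) \<le> 1) \<and> K \<ge> (0::real)"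
    by (intro eventually_conj avg_sq_tail_rare eventually_ge_at_top) auto
  then obtain K where K: "fails_rarely M (1/4) (\<lambda>n \<omega>. avg n \<omega> (sq_tail K) \<le> 1)" "K \<ge> 0"
    using eventually_happens'[OF trivial_limit_at_top_linorder] by blast
  define f where "f L d = min ((real d)\<^sup>2) (real L)" for L d :: nat
  have bdd: "bounded (range (f L))" for L
    by (rule boundedI[of _ "real L"]) (auto simp: f_def)
  have int: "integrable N (f L)" for L
    by (rule N.integrable_const_bound[of _ "real L"]) (auto simp: f_def)
  have bound: "(\<integral>d. f L d \<partial>N) \<le> K + 2" for L
  proof -
    have "fails_rarely M (1/4 + 1/4) (\<lambda>n \<omega>. avg n \<omega> (sq_tail K) \<le> 1
        \<and> \<bar>avg n \<omega> (f L) - (\<integral>d. f L d \<partial>N)\<bar> \<le> 1)"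
      by (intro fails_rarely_conj K conv_in_prob_fails_rarely conv_avg bdd) auto
    then obtain n \<omega> where n: "n \<ge> n0" and a: "avg n \<omega> (sq_tail K) \<le> 1
        \<and> \<bar>avg n \<omega> (f L) - (\<integral>d. f L d \<partial>N)\<bar> \<le> 1"
      by (rule fails_rarely_witness[OF _ _ ev_prob eventually_ge_at_top[of n0]]) auto
    have "avg n \<omega> (f L) \<le> avg n \<omega> (\<lambda>d. K + sq_tail K d)"
      by (rule avg_mono) (use K(2) in \<open>auto simp: f_def sq_tail_def\<close>)
    also have "\<dots> = K + avg n \<omega> (sq_tail K)" using n n0 by (simp add: avg_add avg_const)
    finally show ?thesis using a by linarith
  qed
  have mono: "incseq (\<lambda>L. \<integral>d. f L d \<partial>N)"
    unfolding incseq_def by (intro allI impI integral_mono int) (auto simp: f_def)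
  obtain l where l: "(\<lambda>L. \<integral>d. f L d \<partial>N) \<longlonglongrightarrow> l"
    using incseq_convergent[OF mono, of "K + 2"] bound by blast
  show ?thesis
  proof (rule integrable_monotone_convergence[OF int _ _ l])
    show "AE d in N. mono (\<lambda>L. f L d)" by (auto simp: mono_def f_def)
    show "AE d in N. (\<lambda>L. f L d) \<longlonglongrightarrow> (real d)\<^sup>2"
    proof (intro AE_I2)
      fix d
      have "\<forall>\<^sub>F L in sequentially. f L d = (real d)\<^sup>2"
        using eventually_ge_at_top[of "d\<^sup>2"] by eventually_elim (simp add: f_def min_def flip: of_nat_power)
      then show "(\<lambda>L. f L d) \<longlonglongrightarrow> (real d)\<^sup>2" by (rule tendsto_eventually)
    qed
  qed simp
qed

text \<open>Truncating at squared degree \<open>K\<close> leaves a bounded function, to which the convergence assumption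
  applies. The truncation error is at most the average of \<open>sq_tail K\<close>, which is rarely large by
  uniform integrability; for \<open>N\<close> it vanishes as \<open>K\<close> grows, by dominated convergence.\<close>

theorem conv_dominated:
  assumes g: "\<And>d. \<bar>g d\<bar> \<le> (real d)\<^sup>2"
  shows "conv_in_prob M (\<lambda>n \<omega>. avg n \<omega> g) (\<integral>d. g d \<partial>N)"
proof (rule conv_in_probI[OF ev_prob])
  show "\<forall>\<^sub>F n in sequentially. (\<lambda>\<omega>. avg n \<omega> g) \<in> borel_measurable (M n)"
    using avg_measurable by (intro eventually_sequentiallyI[of n0])
  fix \<epsilon> \<eta> :: real assume \<epsilon>: "\<epsilon> > 0" and \<eta>: "\<eta> > 0"
  define h where "h K d = (if (real d)\<^sup>2 \<le> K then g d else 0)" for K d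
  have "((\<lambda>K. \<integral>d. h K d \<partial>N) \<longlongrightarrow> (\<integral>d. g d \<partial>N)) at_top"
  proof (rule integral_dominated_convergence_at_top[OF _ _ integrable_square])
    show "AE d in N. ((\<lambda>K. h K d) \<longlongrightarrow> g d) at_top"
    proof (intro AE_I2 tendsto_eventually)
      fix d show "\<forall>\<^sub>F K in at_top. h K d = g d"
        using eventually_ge_at_top[of "(real d)\<^sup>2"] by eventually_elim (simp add: h_def)
    qed
    show "\<forall>\<^sub>F K in at_top. AE d in N. norm (h K d) \<le> (real d)\<^sup>2"
      using g by (simp add: h_def)
  qed simp_all
  from tendstoD[OF this, of "\<epsilon> / 3"]
  have "\<forall>\<^sub>F K in at_top. \<bar>(\<integral>d. h K d \<partial>N) - (\<integral>d. g d \<partial>N)\<bar> < \<epsilon> / 3"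
    using \<epsilon> by (simp add: dist_real_def)
  moreover have "\<forall>\<^sub>F K in at_top. fails_rarely M (\<eta>/2) (\<lambda>n \<omega>. avg n \<omega> (sq_tail K) \<le> \<epsilon> / 3)"
    by (rule avg_sq_tail_rare) (use \<epsilon> \<eta> in auto)
  ultimately have "\<forall>\<^sub>F K in at_top. \<bar>(\<integral>d. h K d \<partial>N) - (\<integral>d. g d \<partial>N)\<bar> < \<epsilon> / 3
      \<and> fails_rarely M (\<eta>/2) (\<lambda>n \<omega>. avg n \<omega> (sq_tail K) \<le> \<epsilon> / 3)"
    by (rule eventually_conj)
  then obtain K where K: "\<bar>(\<integral>d. h K d \<partial>N) - (\<integral>d. g d \<partial>N)\<bar> < \<epsilon> / 3"
    "fails_rarely M (\<eta>/2) (\<lambda>n \<omega>. avg n \<omega> (sq_tail K) \<le> \<epsilon> / 3)"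
    using eventually_happens'[OF trivial_limit_at_top_linorder] by blast
  have bdd: "bounded (range (h K))"
  proof (rule boundedI[of _ "max K 0"])
    fix x assume "x \<in> range (h K)"
    then obtain d where "x = h K d" by blast
    then show "norm x \<le> max K 0" using g[of d] by (auto simp: h_def max_def)
  qed
  have "fails_rarely M (\<eta>/2 + \<eta>/2) (\<lambda>n \<omega>. avg n \<omega> (sq_tail K) \<le> \<epsilon> / 3
      \<and> \<bar>avg n \<omega> (h K) - (\<integral>d. h K d \<partial>N)\<bar> \<le> \<epsilon> / 3)"
    by (intro fails_rarely_conj K conv_in_prob_fails_rarely conv_avg bdd) (use \<epsilon> \<eta> in auto)
  then have "fails_rarely M \<eta> (\<lambda>n \<omega>. avg n \<omega> (sq_tail K) \<le> \<epsilon> / 3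
      \<and> \<bar>avg n \<omega> (h K) - (\<integral>d. h K d \<partial>N)\<bar> \<le> \<epsilon> / 3)"
    by simp
  then show "fails_rarely M \<eta> (\<lambda>n \<omega>. \<bar>avg n \<omega> g - (\<integral>d. g d \<partial>N)\<bar> \<le> \<epsilon>)"
  proof (rule fails_rarely_mono, intro always_eventually allI ballI impI)
    fix n \<omega> assume a: "avg n \<omega> (sq_tail K) \<le> \<epsilon> / 3 \<and> \<bar>avg n \<omega> (h K) - (\<integral>d. h K d \<partial>N)\<bar> \<le> \<epsilon> / 3"
    have "\<bar>avg n \<omega> g - avg n \<omega> (h K)\<bar> \<le> avg n \<omega> (\<lambda>d. \<bar>g d - h K d\<bar>)"
      unfolding avg_diff[symmetric] by (rule avg_abs)
    also have "\<dots> \<le> avg n \<omega> (sq_tail K)"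
      by (rule avg_mono) (use g in \<open>auto simp: h_def sq_tail_def\<close>)
    finally show "\<bar>avg n \<omega> g - (\<integral>d. g d \<partial>N)\<bar> \<le> \<epsilon>" using a K(1) by linarith
  qed
qed

abbreviation m1 :: real where "m1 \<equiv> \<integral>d. real d \<partial>N"
abbreviation m2 :: real where "m2 \<equiv> \<integral>d. (real d)\<^sup>2 \<partial>N"

lemma real_le_square: "real d \<le> (real d)\<^sup>2"
  by (cases d) (auto simp: power2_eq_square)

lemma conv_m1: "conv_in_prob M (\<lambda>n \<omega>. avg n \<omega> real) m1"
  by (rule conv_dominated, unfold abs_of_nat, rule real_le_square)

lemma conv_m2: "conv_in_prob M (\<lambda>n \<omega>. avg n \<omega> (\<lambda>d. (real d)\<^sup>2)) m2"
  by (rule conv_dominated) simp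

text \<open>All degrees being positive, the averages that approximate \<open>m1\<close> are at least \<open>1\<close>.\<close>

lemma m1_pos: "m1 > 0"
proof -
  have "fails_rarely M (1/2) (\<lambda>n \<omega>. \<bar>avg n \<omega> real - m1\<bar> \<le> 1/2)"
    by (rule conv_in_prob_fails_rarely[OF conv_m1]) auto
  then obtain n \<omega> where n: "n \<ge> n0" "\<omega> \<in> space (M n)" "\<bar>avg n \<omega> real - m1\<bar> \<le> 1/2"
    by (rule fails_rarely_witness[OF _ _ ev_prob eventually_ge_at_top[of n0]]) auto
  have "avg n \<omega> (\<lambda>_. 1) \<le> avg n \<omega> real"
    by (rule avg_mono) (use pos[OF n(1,2)] in \<open>auto simp: Suc_le_eq\<close>)
  then have "1 \<le> avg n \<omega> real" using n n0 by (simp add: avg_const)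
  then show ?thesis using n(3) by linarith
qed

text \<open>Replacing the random centre by its limit \<open>m2 / m1\<close> changes the average of \<open>f\<close> by little:
  \<open>f\<close> is uniformly continuous on the range relevant for degrees at most \<open>L\<close>, and at most a fraction
  \<open>avg n \<omega> real / L\<close> of the degrees exceeds \<open>L\<close>.\<close>

theorem conv_recentred:
  fixes f :: "real \<Rightarrow> real"
  assumes f: "continuous_on UNIV f" "bounded (range f)"
  shows "conv_in_prob M
    (\<lambda>n \<omega>. avg n \<omega> (\<lambda>d. f (avg n \<omega> (\<lambda>d. (real d)\<^sup>2) / avg n \<omega> real - real d)))
    (\<integral>d. f (m2 / m1 - real d) \<partial>N)"
proof (rule conv_in_probI[OF ev_prob])
  let ?R = "\<lambda>n \<omega>. avg n \<omega> (\<lambda>d. (real d)\<^sup>2) / avg n \<omega> real"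
  show "\<forall>\<^sub>F n in sequentially. (\<lambda>\<omega>. avg n \<omega> (\<lambda>d. f (?R n \<omega> - real d))) \<in> borel_measurable (M n)"
  proof (rule eventually_sequentiallyI[of n0])
    fix n assume n: "n \<ge> n0"
    have fm: "f \<in> borel_measurable borel" using f(1) by (rule borel_measurable_continuous_onI)
    have "(\<lambda>\<omega>. f (?R n \<omega> - real (D n \<omega> i))) \<in> borel_measurable (M n)" if i: "i \<in> {1..n}" for i
      by (intro measurable_compose[OF _ fm] borel_measurable_diff borel_measurable_divide
          avg_measurable n measurable_compose[OF meas[OF n i]]) simp
    then show "(\<lambda>\<omega>. avg n \<omega> (\<lambda>d. f (?R n \<omega> - real d))) \<in> borel_measurable (M n)"
      unfolding avg_def[of n _ "\<lambda>d. f (?R n _ - real d)"]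
      by (intro borel_measurable_divide borel_measurable_sum borel_measurable_const)
  qed
  fix \<epsilon> \<eta> :: real assume \<epsilon>: "\<epsilon> > 0" and \<eta>: "\<eta> > 0"
  let ?a = "m2 / m1"
  obtain C where C: "C > 0" "\<And>x. \<bar>f x\<bar> \<le> C"
    using f(2) unfolding bounded_pos by auto
  (* chosen so that 2 * C, the largest possible change of f, times the fraction (m1 + 1) / L of
     degrees above L is a third of \<epsilon> *)
  define L where "L = 6 * C * (m1 + 1) / \<epsilon>"
  have L: "L > 0" using C \<epsilon> m1_pos by (simp add: L_def)
  have "uniformly_continuous_on {?a - L - 1..?a + 1} f"
    by (rule compact_uniformly_continuous) (use f(1) continuous_on_subset in auto)
  then obtain \<delta> where \<delta>: "\<delta> > 0" "\<And>x y. x \<in> {?a - L - 1..?a + 1} \<Longrightarrow> y \<in> {?a - L - 1..?a + 1} \<Longrightarrow>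
      \<bar>y - x\<bar> < \<delta> \<Longrightarrow> \<bar>f y - f x\<bar> < \<epsilon> / 3"
    using \<epsilon> unfolding uniformly_continuous_on_def dist_real_def by (metis divide_pos_pos zero_less_numeral)
  define \<delta>' where "\<delta>' = min 1 (\<delta> / 2)"
  have bdd: "bounded (range (\<lambda>d. f (?a - real d)))"
    by (rule boundedI[of _ C]) (use C in auto)
  have "fails_rarely M (\<eta>/3 + (\<eta>/3 + \<eta>/3)) (\<lambda>n \<omega>. \<bar>?R n \<omega> - ?a\<bar> \<le> \<delta>' \<and> \<bar>avg n \<omega> real - m1\<bar> \<le> 1
      \<and> \<bar>avg n \<omega> (\<lambda>d. f (?a - real d)) - (\<integral>d. f (?a - real d) \<partial>N)\<bar> \<le> \<epsilon> / 3)"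
    by (intro fails_rarely_conj conv_in_prob_fails_rarely conv_in_prob_divide[OF conv_m2 conv_m1 _ ev_prob]
        conv_m1 conv_avg[OF bdd]) (use \<epsilon> \<eta> \<delta> m1_pos in \<open>auto simp: \<delta>'_def\<close>)
  then have "fails_rarely M \<eta> (\<lambda>n \<omega>. \<bar>?R n \<omega> - ?a\<bar> \<le> \<delta>' \<and> \<bar>avg n \<omega> real - m1\<bar> \<le> 1
      \<and> \<bar>avg n \<omega> (\<lambda>d. f (?a - real d)) - (\<integral>d. f (?a - real d) \<partial>N)\<bar> \<le> \<epsilon> / 3)"
    by simp
  then show "fails_rarely M \<eta> (\<lambda>n \<omega>.
      \<bar>avg n \<omega> (\<lambda>d. f (?R n \<omega> - real d)) - (\<integral>d. f (?a - real d) \<partial>N)\<bar> \<le> \<epsilon>)"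
  proof (rule fails_rarely_mono, intro eventually_sequentiallyI[of n0] ballI impI)
    fix n \<omega> assume n: "n \<ge> n0" and h: "\<bar>?R n \<omega> - ?a\<bar> \<le> \<delta>' \<and> \<bar>avg n \<omega> real - m1\<bar> \<le> 1
      \<and> \<bar>avg n \<omega> (\<lambda>d. f (?a - real d)) - (\<integral>d. f (?a - real d) \<partial>N)\<bar> \<le> \<epsilon> / 3"
    define r where "r = ?R n \<omega>"
    have "\<bar>r - ?a\<bar> \<le> \<delta>'" using h unfolding r_def by blast
    moreover have "\<delta>' \<le> 1" "\<delta>' < \<delta>" using \<delta>(1) by (auto simp: \<delta>'_def)
    ultimately have r: "\<bar>r - ?a\<bar> \<le> 1" "\<bar>r - ?a\<bar> < \<delta>" by linarith+
    have "\<bar>avg n \<omega> (\<lambda>d. f (r - real d)) - avg n \<omega> (\<lambda>d. f (?a - real d))\<bar>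
        \<le> avg n \<omega> (\<lambda>d. \<bar>f (r - real d) - f (?a - real d)\<bar>)"
      unfolding avg_diff[symmetric] by (rule avg_abs)
    also have "\<dots> \<le> avg n \<omega> (\<lambda>d. \<epsilon> / 3 + 2 * C / L * real d)"
    proof (rule avg_mono)
      fix i
      let ?d = "real (D n \<omega> i)"
      show "\<bar>f (r - ?d) - f (?a - ?d)\<bar> \<le> \<epsilon> / 3 + 2 * C / L * ?d"
      proof (cases "?d \<le> L")
        case True
        have "\<bar>f (r - ?d) - f (?a - ?d)\<bar> < \<epsilon> / 3"
          by (rule \<delta>(2)) (use True r in auto)
        moreover have "2 * C / L * ?d \<ge> 0" using C L by simp
        ultimately show ?thesis by linarith
      next
        case False
        have "\<bar>f (r - ?d) - f (?a - ?d)\<bar> \<le> 2 * C"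
          using C(2)[of "r - ?d"] C(2)[of "?a - ?d"] by linarith
        also have "2 * C \<le> 2 * C / L * ?d" using False C L by (simp add: field_simps)
        finally show ?thesis using \<epsilon> by simp
      qed
    qed
    also have "\<dots> = \<epsilon> / 3 + 2 * C / L * avg n \<omega> real"
      using n n0 unfolding avg_add avg_cmult by (simp add: avg_const)
    also have "\<dots> \<le> \<epsilon> / 3 + 2 * C / L * (m1 + 1)"
      using h C L by (intro add_left_mono mult_left_mono) auto
    also have "2 * C / L * (m1 + 1) = \<epsilon> / 3"
    proof -
      have "2 * C / (6 * C * s / \<epsilon>) * s = \<epsilon> / 3" if "s > 0" for s
        using that C(1) \<epsilon> by (simp add: field_simps)
      then show ?thesis using m1_pos by (simp add: L_def)
    qed
    finally show "\<bar>avg n \<omega> (\<lambda>d. f (?R n \<omega> - real d)) - (\<integral>d. f (?a - real d) \<partial>N)\<bar> \<le> \<epsilon>"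
      using h unfolding r_def by linarith
  qed
qed

end

section \<open>Degrees and local convergence\<close>

text \<open>All edges at the root lead to vertices at distance at most \<open>1\<close>.\<close>

lemma gdegree_ball:
  assumes "good_rooted X" "r \<ge> 1"
  shows "gdegree (fst (rooted_ball X r)) (snd X) = gdegree (fst X) (snd X)"
proof -
  let ?B = "fst (rooted_ball X r)" and ?o = "snd X"
  have o: "?o \<in> verts ?B" using root_in_ball[of X r] assms by (simp add: good_rooted_def)
  have near: "v \<in> verts ?B" if "(?o, v) \<in> adj (fst X)" for v
  proof -
    have "(?o, v) \<in> adj (fst X) ^^ 1" using that by simp
    then have "gdist (fst X) ?o v \<le> enat r" using assms(2) gdist_le_iff by metis
    moreover have "v \<in> verts (fst X)" using adj_verts[OF _ that] assms(1) by (simp add: good_rooted_def)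
    ultimately show ?thesis by (simp add: verts_ball)
  qed
  have mB: "multigraph ?B" using assms(1) by (intro multigraph_ball) (simp add: good_rooted_def)
  have "(?o, v) \<in> adj ?B \<longleftrightarrow> (?o, v) \<in> adj (fst X)" for v
    using mult_ball[OF o, of v] near[of v] adj_verts[OF mB, of ?o v] by (auto simp: adj_def)
  then have "{v. (?o, v) \<in> adj ?B} = {v. (?o, v) \<in> adj (fst X)}" by blast
  moreover have "mult ?B ?o v = mult (fst X) ?o v" if "(?o, v) \<in> adj (fst X)" for v
    by (rule mult_ball[OF o near[OF that]])
  ultimately show ?thesis
    using mult_ball[OF o o] by (simp add: gdegree_def)
qed

lemma gdegree_eq_of_iso_balls:
  assumes "good_rooted X" "good_rooted Y" "r \<ge> 1"
    and "rooted_isomorphic (rooted_ball X r) (rooted_ball Y r)"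
  shows "gdegree (fst X) (snd X) = gdegree (fst Y) (snd Y)"
proof -
  obtain f where f: "is_rooted_iso f (rooted_ball X r) (rooted_ball Y r)"
    using assms(4) by (auto simp: rooted_isomorphic_def)
  have "gdegree (fst (rooted_ball Y r)) (f (snd X)) = gdegree (fst (rooted_ball X r)) (snd X)"
    using assms(1,2) root_in_ball[of X r]
    by (intro iso_degree[OF f] multigraph_ball) (simp_all add: good_rooted_def)
  then show ?thesis
    using f assms by (simp add: gdegree_ball is_rooted_iso_def)
qed

text \<open>Distances below \<open>1\<close> require isomorphic balls of some positive radius. So the degree of the
  root is locally constant, hence every function of it is continuous.\<close>

lemma root_degree_eq_of_dist:
  assumes "dist H H' < 1"
  shows "root_degree H = root_degree H'"
  using assms
proof (transfer)
  fix X Y :: "nat mgraph \<times> nat"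
  assume "rgraph_rel X X" "rgraph_rel Y Y" and d: "local_dist X Y < 1"
  then have good: "good_rooted X" "good_rooted Y" by (auto simp: rgraph_rel_def)
  let ?I = "{r. rooted_isomorphic (rooted_ball X r) (rooted_ball Y r)}"
  have "\<exists>r\<in>?I. r \<ge> 1"
  proof (rule ccontr)
    assume "\<not> (\<exists>r\<in>?I. r \<ge> 1)"
    then have "(SUP r\<in>?I. of_nat r :: ennreal) = 0"
      by (auto simp: bot_ennreal[symmetric] Suc_le_eq)
    then show False using d by (simp add: local_dist_def)
  qed
  then show "gdegree (fst X) (snd X) = gdegree (fst Y) (snd Y)"
    using gdegree_eq_of_iso_balls[OF good] by blast
qed

lemma continuous_on_root_degree:
  fixes g :: "nat \<Rightarrow> 'b :: metric_space"
  shows "continuous_on UNIV (\<lambda>H. g (root_degree H))"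
  unfolding continuous_on_iff
proof (intro ballI allI impI)
  fix H and \<epsilon> :: real assume "\<epsilon> > 0"
  then show "\<exists>\<delta>>0. \<forall>H'\<in>UNIV. dist H' H < \<delta> \<longrightarrow> dist (g (root_degree H')) (g (root_degree H)) < \<epsilon>"
    by (intro exI[of _ 1]) (auto dest: root_degree_eq_of_dist)
qed

lemma measurable_root_degree: "root_degree \<in> measurable borel (count_space UNIV)"
proof (rule measurableI)
  fix A :: "nat set"
  have "open (root_degree -` A)"
    unfolding open_dist
  proof
    fix H assume "H \<in> root_degree -` A"
    then show "\<exists>\<delta>>0. \<forall>H'. dist H' H < \<delta> \<longrightarrow> H' \<in> root_degree -` A"
      by (intro exI[of _ 1]) (auto dest: root_degree_eq_of_dist)
  qed
  then show "root_degree -` A \<inter> space borel \<in> sets borel" by auto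
qed simp

lemma root_degree_component_class:
  assumes G: "multigraph G" "finite (verts G)" and i: "i \<in> verts G"
  shows "root_degree (component_class G i) = gdegree G i"
proof -
  have "finite {w. (v, w) \<in> adj G}" for v
    by (rule finite_subset[OF _ G(2)]) (auto dest: adj_verts[OF G(1)])
  then have "locally_finite G" by (simp add: locally_finite_def)
  then have "good_rooted (graph_component G i, i)" using good_component[OF G(1) _ i] by blast
  then have "rgraph_rel (graph_component G i, i) (graph_component G i, i)"
    by (simp add: rgraph_rel_def rooted_isomorphic_refl)
  then have "root_degree (component_class G i) = gdegree (graph_component G i) i"
    unfolding component_class_def by (simp add: root_degree.abs_eq)
  also have "\<dots> = gdegree G i"
  proof -
    have m: "mult (graph_component G i) i v = mult G i v" for v
      by (auto simp: graph_component_def induced_subgraph_def adj_def)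
    then have "(i, v) \<in> adj (graph_component G i) \<longleftrightarrow> (i, v) \<in> adj G" for v
      by (simp add: adj_def)
    then show ?thesis by (simp add: gdegree_def m)
  qed
  finally show ?thesis .
qed

text \<open>The stationary bias of a vertex is the quotient of the second and the first empirical
  moment of the degrees, minus the degree of that vertex, hence a function of the array of degrees.
  Local convergence is used for bounded functions of the degree of the root, which are continuous test functions.\<close>

theorem stationary_bias_measure_conv:
  fixes M :: "nat \<Rightarrow> 'w measure" and G :: "nat \<Rightarrow> 'w \<Rightarrow> nat mgraph" and \<Lambda> :: "rgraph measure"
  assumes n0: "n0 > 0" and rg: "\<And>n. n \<ge> n0 \<Longrightarrow> random_graph (M n) n (G n)"
    and deg: "\<And>n \<omega> i. n \<ge> n0 \<Longrightarrow> \<omega> \<in> space (M n) \<Longrightarrow> i \<in> {1..n} \<Longrightarrow> gdegree (G n \<omega>) i > 0"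
    and ui: "uniformly_integrable {(n, i). n \<ge> n0 \<and> i \<in> {1..n}} (\<lambda>(n, i). M n)
              (\<lambda>(n, i) \<omega>. (real (gdegree (G n \<omega>) i))\<^sup>2)"
    and \<Lambda>: "prob_space \<Lambda>" "sets \<Lambda> = sets borel" and lc: "local_conv_in_prob M G \<Lambda>"
  shows "weak_conv_in_prob M (\<lambda>n \<omega>. stationary_bias_measure (G n \<omega>)) (limit_law \<Lambda>)"
proof -
  define N where "N = distr \<Lambda> (count_space UNIV) root_degree"
  have rd: "root_degree \<in> measurable \<Lambda> (count_space UNIV)"
    using measurable_root_degree \<Lambda>(2) by (simp cong: measurable_cong_sets)
  have int_N: "(\<integral>d. g d \<partial>N) = (\<integral>H. g (root_degree H) \<partial>\<Lambda>)" for g :: "nat \<Rightarrow> real"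
    unfolding N_def by (rule integral_distr[OF rd]) simp
  have graph: "multigraph (G n \<omega>)" "verts (G n \<omega>) = {1..n}" if "n \<ge> n0" "\<omega> \<in> space (M n)" for n \<omega>
    using rg[OF that(1)] that(2) by (auto simp: random_graph_def)
  interpret degree_array M "\<lambda>n \<omega>. gdegree (G n \<omega>)" N n0
  proof (rule degree_array.intro)
    show "prob_space (M n)" if "n \<ge> n0" for n using rg[OF that] by (simp add: random_graph_def)
    show "(\<lambda>\<omega>. gdegree (G n \<omega>) i) \<in> measurable (M n) (count_space UNIV)"
      if n: "n \<ge> n0" and i: "i \<in> {1..n}" for n i
    proof -
      have m: "(\<lambda>\<omega>. mult (G n \<omega>) i j) \<in> measurable (M n) (count_space UNIV)" if "j \<in> {1..n}" for j
        using rg[OF n] i that by (simp add: random_graph_def)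
      have "(\<lambda>\<omega>. (\<Sum>j\<in>{1..n}. real (mult (G n \<omega>) i j)) + real (mult (G n \<omega>) i i)) \<in> borel_measurable (M n)"
        by (intro borel_measurable_add borel_measurable_sum measurable_compose[OF m] i) auto
      also have "?this \<longleftrightarrow> (\<lambda>\<omega>. real (gdegree (G n \<omega>) i)) \<in> borel_measurable (M n)"
        by (rule measurable_cong) (simp add: gdegree_eq_sum[of "G n _"] graph[OF n])
      (* rounding down transfers measurability from the reals to the discrete naturals *)
      finally have "(\<lambda>\<omega>. nat \<lfloor>real (gdegree (G n \<omega>) i)\<rfloor>) \<in> measurable (M n) (count_space UNIV)"
        by measurable
      then show ?thesis by simp
    qed
    show "prob_space N" unfolding N_def by (rule prob_space.prob_space_distr[OF \<Lambda>(1) rd])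
    show "sets N = UNIV" by (simp add: N_def)
    fix g :: "nat \<Rightarrow> real" assume g: "bounded (range g)"
    have "bounded (range (\<lambda>H. g (root_degree H)))"
      by (rule bounded_subset[OF g]) auto
    then have "conv_in_prob M
        (\<lambda>n \<omega>. (\<Sum>i\<in>{1..n}. g (root_degree (component_class (G n \<omega>) i))) / real n) (\<integral>d. g d \<partial>N)"
      using lc continuous_on_root_degree[of g] unfolding local_conv_in_prob_def int_N by blast
    then show "conv_in_prob M (\<lambda>n \<omega>. (\<Sum>i\<in>{1..n}. g (gdegree (G n \<omega>) i)) / real n) (\<integral>d. g d \<partial>N)"
    proof (rule conv_in_prob_cong, intro eventually_sequentiallyI[of n0] ballI)
      fix n \<omega> assume "n \<ge> n0" "\<omega> \<in> space (M n)"
      from graph[OF this] show "(\<Sum>i\<in>{1..n}. g (root_degree (component_class (G n \<omega>) i))) / real n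
          = (\<Sum>i\<in>{1..n}. g (gdegree (G n \<omega>) i)) / real n"
        by (simp add: root_degree_component_class)
    qed
  qed (use n0 deg ui in auto)
  show ?thesis
    unfolding weak_conv_in_prob_def
  proof (intro allI impI, elim conjE)
    fix f :: "real \<Rightarrow> real" assume f: "continuous_on UNIV f" "bounded (range f)"
    have fm: "f \<in> borel_measurable borel" using f(1) by (rule borel_measurable_continuous_onI)
    have bias: "stationary_bias (G n \<omega>) i
        = avg n \<omega> (\<lambda>d. (real d)\<^sup>2) / avg n \<omega> real - real (gdegree (G n \<omega>) i)"
      if "n \<ge> n0" "\<omega> \<in> space (M n)" for n \<omega> i
      using graph[OF that] n0 that(1)
      by (simp add: stationary_bias_def stationary_prob_def avg_def power2_eq_square
          sum_divide_distrib[symmetric])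
    have "(\<integral>x. f x \<partial>limit_law \<Lambda>) = (\<integral>H. f (m2 / m1 - real (root_degree H)) \<partial>\<Lambda>)"
      unfolding limit_law_def Let_def int_N
      by (rule integral_distr[OF _ fm]) (rule measurable_compose[OF rd], simp)
    also have "\<dots> = (\<integral>d. f (m2 / m1 - real d) \<partial>N)" by (simp add: int_N)
    finally have lim: "(\<integral>x. f x \<partial>limit_law \<Lambda>) = (\<integral>d. f (m2 / m1 - real d) \<partial>N)" .
    show "conv_in_prob M (\<lambda>n \<omega>. \<integral>x. f x \<partial>stationary_bias_measure (G n \<omega>)) (\<integral>x. f x \<partial>limit_law \<Lambda>)"
      unfolding lim
    proof (rule conv_in_prob_cong[OF conv_recentred[OF f]], intro eventually_sequentiallyI[of n0] ballI)
      fix n \<omega> assume n: "n \<ge> n0" "\<omega> \<in> space (M n)"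
      show "avg n \<omega> (\<lambda>d. f (avg n \<omega> (\<lambda>d. (real d)\<^sup>2) / avg n \<omega> real - real d))
          = (\<integral>x. f x \<partial>stationary_bias_measure (G n \<omega>))"
        unfolding stationary_bias_measure_def
        using graph[OF n] by (simp add: integral_empirical_measure[OF _ fm] bias[OF n]
            avg_def[of n \<omega> "\<lambda>d. f (_ - real d)"])
    qed
  qed
qed

section \<open>Convergence of the friendship bias\<close>

theorem theorem4p1:
  fixes e :: exploration
    and M :: "nat \<Rightarrow> 'w measure"
    and G :: "nat \<Rightarrow> 'w \<Rightarrow> nat mgraph"
  assumes "\<forall>n\<ge>min_size e. random_graph (M n) n (G n)"
    and "\<forall>n\<ge>min_size e. \<forall>\<omega>\<in>space (M n). admissible e (G n \<omega>)"
  shows "(\<forall>n\<ge>min_size e.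
            (AE \<omega> in M n. ergodic_exploration e (G n \<omega>)) \<longrightarrow>
            (AE \<omega> in M n. weak_conv_m (\<lambda>k. bias_measure e k (G n \<omega>))
                                     (stationary_bias_measure (G n \<omega>))))
       \<and> (\<forall>\<Lambda> :: rgraph measure.
            (\<forall>\<^sub>F n in sequentially. AE \<omega> in M n. ergodic_exploration e (G n \<omega>)) \<longrightarrow>
            uniformly_integrable {(n, i). n \<ge> min_size e \<and> i \<in> {1..n}} (\<lambda>(n, i). M n)
              (\<lambda>(n, i) \<omega>. (real (gdegree (G n \<omega>) i))\<^sup>2) \<longrightarrow>
            prob_space \<Lambda> \<longrightarrow> sets \<Lambda> = sets borel \<longrightarrow>
            (AE H in \<Lambda>. limit_tree e H) \<longrightarrow>
            local_conv_in_prob M G \<Lambda> \<longrightarrow>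
            weak_conv_in_prob M (\<lambda>n \<omega>. stationary_bias_measure (G n \<omega>)) (limit_law \<Lambda>))"
proof (intro conjI allI impI)
  have size: "min_size e > 0" by (cases e) auto
  have graph: "multigraph (G n \<omega>)" "verts (G n \<omega>) = {1..n}"
    if "n \<ge> min_size e" "\<omega> \<in> space (M n)" for n \<omega>
    using assms(1) that by (auto simp: random_graph_def)
  {
    fix n assume n: "n \<ge> min_size e" and erg: "AE \<omega> in M n. ergodic_exploration e (G n \<omega>)"
    show "AE \<omega> in M n. weak_conv_m (\<lambda>k. bias_measure e k (G n \<omega>)) (stationary_bias_measure (G n \<omega>))"
      using erg
    proof (rule AE_mp, intro AE_I2 impI)
      fix \<omega> assume \<omega>: "\<omega> \<in> space (M n)" and "ergodic_exploration e (G n \<omega>)"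
      then show "weak_conv_m (\<lambda>k. bias_measure e k (G n \<omega>)) (stationary_bias_measure (G n \<omega>))"
        using graph[OF n \<omega>] assms(2) n size by (intro bias_measure_weak_conv) auto
    qed
  next
    fix \<Lambda> :: "rgraph measure"
    assume *: "uniformly_integrable {(n, i). n \<ge> min_size e \<and> i \<in> {1..n}} (\<lambda>(n, i). M n)
        (\<lambda>(n, i) \<omega>. (real (gdegree (G n \<omega>) i))\<^sup>2)"
      "prob_space \<Lambda>" "sets \<Lambda> = sets borel" "local_conv_in_prob M G \<Lambda>"
    show "weak_conv_in_prob M (\<lambda>n \<omega>. stationary_bias_measure (G n \<omega>)) (limit_law \<Lambda>)"
    proof (rule stationary_bias_measure_conv[OF size _ _ *])
      fix n \<omega> i assume n: "n \<ge> min_size e" "\<omega> \<in> space (M n)" "i \<in> {1..n}"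
      then have "admissible e (G n \<omega>)" "i \<in> verts (G n \<omega>)" using assms(2) graph by auto
      then show "gdegree (G n \<omega>) i > 0" by (cases e) fastforce+
    qed (use assms(1) in blast)
  }
qed

end
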